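(* Let $M$ be a favourable $\mathbb U$-module (with cyclic generator $v_M$, and with the ordered basis $f_1,\dots,f_N$ of $\mathfrak N$ and the homogeneous monomial order for which it is favourable fixed), and let $P(M)$ be the associated normal lattice polytope. Then: (i) Let $S(M)$ be the set of lattice points in $P(M)$. For every $n\ge 1$ the set $\{\mathbf f^{\mathbf p}v_M^{\otimes n}\mid \mathbf p\in nS(M)\}$ is a basis of $M^{\odot n}$, and likewise (with $v_M^{\otimes n}$ replaced by its image in the graded space, and $\mathbf f^{\mathbf p}$ acting through $S(\mathfrak N)$) of the graded versions $\mathrm{gr}^a M^{\odot n}$ and $\mathrm{gr}^t M^{\odot n}$.
   Context: $\mathbb U$ is a complex algebraic unipotent group with Lie algebra $\mathfrak N$, acting on a finite dimensional complex vector space $M$ which is cyclic: $M=\mathrm U(\mathfrak N)v_M$ for a fixed $v_M\neq 0$. The abelian Lie algebra with underlying vector space $\mathfrak N$ is $\mathfrak N^a$, so $\mathrm U(\mathfrak N^a)=S(\mathfrak N)$. Fix an ordered basis $f_1>\dots>f_N$ of $\mathfrak N$. For $\mathbf p\in\mathbb Z_{\ge0}^N$ put $\mathbf f^{\mathbf p}=f_1^{p_1}\cdots f_N^{p_N}$ and $|\mathbf p|=\sum p_i$. An (induced) homogeneous monomial order is a total order on $\mathbb Z_{\ge 0}^N$ (equivalently on the monomials $\mathbf f^{\mathbf p}$), compatible with addition, with $\mathbf e_1>\dots>\mathbf e_N$, and such that $|\mathbf p|<|\mathbf q|$ implies $\mathbf p<\mathbf q$. Essential exponents: for a cyclic module $L$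 with generator $v_L$, $\mathbf p$ is essential for $L$ if $\mathbf f^{\mathbf p}v_L\notin\mathrm{span}\{\mathbf f^{\mathbf q}v_L:\mathbf q<\mathbf p\}$; $\mathrm{es}(L)\subset\mathbb Z_{\ge 0}^N$ is the set of essential exponents. Cartan component: $M^{\odot n}=\mathrm U(\mathfrak N)(v_M^{\otimes n})\subseteq M^{\otimes n}$, a cyclic module with generator $v_M^{\otimes n}$. Graded versions of a cyclic module $L$: $\mathrm{gr}^aL=\bigoplus_{s\ge 0}L_s/L_{s-1}$ with $L_s=\mathrm{span}\{x_1\cdots x_lv_L: l\le s,\ x_i\in\mathfrak N\}$; $\mathrm{gr}^tL=\bigoplus_{\mathbf p}F_{\mathbf p}(L)/F_{<\mathbf p}(L)$ with $F_{\mathbf p}(L)=\mathrm{span}\{\mathbf f^{\mathbf q}v_L:\mathbf q\le\mathbf p\}$, $F_{<\mathbf p}(L)=\mathrm{span}\{\mathbf f^{\mathbf q}v_L:\mathbf q<\mathbf p\}$. Both are cyclic modules over $S(\mathfrak N)=\mathbb C[f_1,\dots,f_N]$, generated by the image of $v_L$ (each $f_i$ acts by the map it induces on graded pieces, of degree $1$, resp. degree $\mathbf e_i$). A convex lattice polytope $P$ (convex hull of finitely many points of $\mathbb Z^N$) is normal if for every $n\ge1$ each lattice point of $nP$ is a sum of $n$ lattice points of $P$. For a finite set $S$, $nS$ denotes the $n$-fold Minkowski sum $S+\dots+S$. $M$ is favourable if there exist an ordered basis of $\mathfrak N$ and an induced homogeneous monomial order such that: (1) there is a normal polytope $P(M)\subset\mathbb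 R^N$ whose set of lattice points $S(M)$ equals $\mathrm{es}(M)$; (2) $\dim M^{\odot n}=\sharp\, nS(M)$ for all $n\in\mathbb N$. *)

theory Defs
  imports
    "HOL-Analysis.Analysis"
    "HOL-Analysis.Finite_Function_Topology"
    "HOL-Library.Set_Algebras"
    "HOL-Library.Function_Algebras"
    "HOL-Algebra.Module"
begin

section \<open>Unipotent algebraic groups, their Lie algebras and representations\<close>

text \<open>
  Linear algebraic groups are taken as Zariski closed subgroups of \<open>GL\<^sub>m(\<complex>)\<close>.  A unipotent group
  has determinant 1, so its regular functions are exactly the restrictions of polynomials in the
  matrix entries; no inverse of the determinant is needed.
\<close>

inductive matrix_polynomial :: "(complex^'m^'m \<Rightarrow> complex) \<Rightarrow> bool" where
  const: "matrix_polynomial (\<lambda>g. c)"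
| entry: "matrix_polynomial (\<lambda>g. g $ i $ j)"
| add: "matrix_polynomial p \<Longrightarrow> matrix_polynomial q \<Longrightarrow> matrix_polynomial (\<lambda>g. p g + q g)"
| mult: "matrix_polynomial p \<Longrightarrow> matrix_polynomial q \<Longrightarrow> matrix_polynomial (\<lambda>g. p g * q g)"

text \<open>The power \<open>^\<close> on \<open>complex^'m^'m\<close> is componentwise, hence the iterated matrix product.\<close>

definition unipotent_matrix :: "complex^'m^'m \<Rightarrow> bool" where
  "unipotent_matrix g \<longleftrightarrow> (\<exists>k. (((**) (g - mat 1)) ^^ k) (mat 1) = 0)"

definition unipotent_algebraic_group :: "(complex^'m^'m) set \<Rightarrow> bool" where
  "unipotent_algebraic_group U \<longleftrightarrow>
     (\<exists>I. (\<forall>p\<in>I. matrix_polynomial p) \<and> U = {g. invertible g \<and> (\<forall>p\<in>I. p g = 0)}) \<and>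
     mat 1 \<in> U \<and> (\<forall>g\<in>U. \<forall>h\<in>U. g ** h \<in> U) \<and> (\<forall>g\<in>U. matrix_inv g \<in> U) \<and>
     (\<forall>g\<in>U. unipotent_matrix g)"

definition matrix_scale :: "complex \<Rightarrow> complex^'m^'m \<Rightarrow> complex^'m^'m" where
  "matrix_scale c X = (\<chi> i j. c * X $ i $ j)"

lemma vector_space_matrix_scale: "vector_space matrix_scale"
  by unfold_locales (auto simp: matrix_scale_def vec_eq_iff algebra_simps)

text \<open>The Lie algebra is the tangent space at the identity.\<close>

definition derivative_at_one ::
    "(complex^'m^'m \<Rightarrow> complex) \<Rightarrow> complex^'m^'m \<Rightarrow> complex \<Rightarrow> bool" where
  "derivative_at_one p X c \<longleftrightarrow> ((\<lambda>t. p (mat 1 + matrix_scale t X)) has_field_derivative c) (at 0)"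

definition lie_algebra :: "(complex^'m^'m) set \<Rightarrow> (complex^'m^'m) set" where
  "lie_algebra U =
     {X. \<forall>p. matrix_polynomial p \<and> (\<forall>g\<in>U. p g = 0) \<longrightarrow> derivative_at_one p X 0}"

definition rational_representation ::
    "(complex^'m^'m) set \<Rightarrow> (complex^'m^'m \<Rightarrow> complex^'d^'d) \<Rightarrow> bool" where
  "rational_representation U \<rho> \<longleftrightarrow>
     \<rho> (mat 1) = mat 1 \<and> (\<forall>g\<in>U. \<forall>h\<in>U. \<rho> (g ** h) = \<rho> g ** \<rho> h) \<and>
     (\<forall>i j. \<exists>p. matrix_polynomial p \<and> (\<forall>g\<in>U. \<rho> g $ i $ j = p g))"

text \<open>
  The action of the Lie algebra is the differential of \<open>\<rho>\<close> at the identity: each matrix coefficient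
  of \<open>\<rho>\<close> is extended to a polynomial and differentiated in the direction \<open>X\<close>; for tangent
  vectors \<open>X\<close> the result does not depend on the extension.
\<close>

definition differential ::
    "(complex^'m^'m) set \<Rightarrow> (complex^'m^'m \<Rightarrow> complex^'d^'d) \<Rightarrow> complex^'m^'m \<Rightarrow> complex^'d^'d" where
  "differential U \<rho> X =
     (\<chi> i j. THE c. \<exists>p. matrix_polynomial p \<and> (\<forall>g\<in>U. \<rho> g $ i $ j = p g) \<and> derivative_at_one p X c)"

definition lie_action ::
    "(complex^'m^'m) set \<Rightarrow> (complex^'m^'m \<Rightarrow> complex^'d^'d) \<Rightarrow>
     complex^'m^'m \<Rightarrow> complex^'d \<Rightarrow> complex^'d" where
  "lie_action U \<rho> X v = differential U \<rho> X *v v"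

definition ordered_basis :: "nat \<Rightarrow> (nat \<Rightarrow> complex^'m^'m) \<Rightarrow> (complex^'m^'m) set \<Rightarrow> bool" where
  "ordered_basis N f \<gg> \<longleftrightarrow>
     inj_on f {..<N} \<and> \<not> Modules.module.dependent matrix_scale (f ` {..<N}) \<and>
     Modules.module.span matrix_scale (f ` {..<N}) = \<gg>"

section \<open>Tensor powers\<close>

text \<open>
  The tensor power \<open>(\<complex>\<^sup>d)\<^sup>\<otimes>\<^sup>n\<close> is modelled by the functions on words over the index type that are
  supported on words of length \<open>n\<close>: the value at \<open>[i\<^sub>1, \<dots>, i\<^sub>n]\<close> is the coefficient of
  \<open>e\<^sub>i\<^sub>1 \<otimes> \<dots> \<otimes> e\<^sub>i\<^sub>n\<close>.
\<close>

type_synonym 'd tensor = "'d list \<Rightarrow> complex"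

definition tensor_scale :: "complex \<Rightarrow> 'd tensor \<Rightarrow> 'd tensor" where
  "tensor_scale c T = (\<lambda>w. c * T w)"

lemma vector_space_tensor_scale: "vector_space tensor_scale"
  by unfold_locales (auto simp: tensor_scale_def fun_eq_iff algebra_simps)

definition pure_tensor :: "(complex^'d) list \<Rightarrow> 'd tensor" where
  "pure_tensor vs = (\<lambda>w. if length w = length vs then \<Prod>k<length vs. (vs ! k) $ (w ! k) else 0)"

definition tensor_power_vector :: "nat \<Rightarrow> complex^'d \<Rightarrow> 'd tensor" where
  "tensor_power_vector n v = pure_tensor (replicate n v)"

definition tensor_action :: "complex^'d^'d \<Rightarrow> 'd tensor \<Rightarrow> 'd tensor" where
  "tensor_action A T = (\<lambda>w. \<Sum>k<length w. \<Sum>j\<in>UNIV. A $ (w ! k) $ j * T (w[k := j]))"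

lemma tensor_action_pure_tensor:
  "tensor_action A (pure_tensor vs) = (\<Sum>k<length vs. pure_tensor (vs[k := A *v (vs ! k)]))"
proof
  fix w
  have eq: "(\<Sum>j\<in>UNIV. A $ (w ! k) $ j * pure_tensor vs (w[k := j]))
      = pure_tensor (vs[k := A *v (vs ! k)]) w"
    if len: "length w = length vs" and k: "k < length vs" for k
  proof -
    let ?R = "\<Prod>l\<in>{..<length vs} - {k}. (vs ! l) $ (w ! l)"
    have "pure_tensor vs (w[k := j]) = (vs ! k) $ j * ?R" for j
      using len k by (simp add: pure_tensor_def prod.remove[of "{..<length vs}" k])
    moreover have "pure_tensor (vs[k := A *v (vs ! k)]) w = (A *v (vs ! k)) $ (w ! k) * ?R"
      using len k by (simp add: pure_tensor_def prod.remove[of "{..<length vs}" k])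
    ultimately show ?thesis
      by (simp add: matrix_vector_mult_def sum_distrib_right mult.assoc)
  qed
  have sum_app: "(\<Sum>k\<in>K. F k) w = (\<Sum>k\<in>K. F k w)" for K and F :: "nat \<Rightarrow> 'a tensor"
    by (induction K rule: infinite_finite_induct) auto
  show "tensor_action A (pure_tensor vs) w = (\<Sum>k<length vs. pure_tensor (vs[k := A *v (vs ! k)])) w"
  proof (cases "length w = length vs")
    case True
    then show ?thesis by (simp add: tensor_action_def sum_app eq)
  next
    case False
    then show ?thesis by (simp add: tensor_action_def sum_app pure_tensor_def)
  qed
qed

definition lie_tensor_action ::
    "(complex^'m^'m) set \<Rightarrow> (complex^'m^'m \<Rightarrow> complex^'d^'d) \<Rightarrow> complex^'m^'m \<Rightarrow> 'd tensor \<Rightarrow> 'd tensor"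
  where "lie_tensor_action U \<rho> X = tensor_action (differential U \<rho> X)"

section \<open>Exponents, monomial orders and polytopes\<close>

text \<open>
  Vectors indexed by \<open>1, \<dots>, N\<close> are finitely supported functions on \<open>nat\<close> with keys below \<open>N\<close>;
  the basis vector \<open>f\<^sub>i\<close> of the literature is \<open>f (i - 1)\<close>.
\<close>

type_synonym exponent = "nat \<Rightarrow>\<^sub>0 nat"

definition exponents :: "nat \<Rightarrow> exponent set" where
  "exponents N = {p. Poly_Mapping.keys p \<subseteq> {..<N}}"

definition total_degree :: "exponent \<Rightarrow> nat" where
  "total_degree p = (\<Sum>i\<in>Poly_Mapping.keys p. Poly_Mapping.lookup p i)"

text \<open>\<open>lt p q\<close> stands for the strict relation \<open>p < q\<close>.\<close>

definition homogeneous_monomial_order :: "nat \<Rightarrow> (exponent \<Rightarrow> exponent \<Rightarrow> bool) \<Rightarrow> bool" where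
  "homogeneous_monomial_order N lt \<longleftrightarrow>
     irreflp_on (exponents N) lt \<and> transp_on (exponents N) lt \<and> totalp_on (exponents N) lt \<and>
     (\<forall>p\<in>exponents N. \<forall>q\<in>exponents N. \<forall>r\<in>exponents N. lt p q \<longrightarrow> lt (p + r) (q + r)) \<and>
     (\<forall>i j. i < j \<and> j < N \<longrightarrow> lt (Poly_Mapping.single j 1) (Poly_Mapping.single i 1)) \<and>
     (\<forall>p\<in>exponents N. \<forall>q\<in>exponents N. total_degree p < total_degree q \<longrightarrow> lt p q)"

definition minkowski_multiple :: "nat \<Rightarrow> 'a::comm_monoid_add set \<Rightarrow> 'a set" where
  "minkowski_multiple n S = ((+) S ^^ n) {0}"

definition lattice_points :: "nat \<Rightarrow> (nat \<Rightarrow>\<^sub>0 real) set \<Rightarrow> (nat \<Rightarrow>\<^sub>0 real) set" where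
  "lattice_points N P =
     {x \<in> P. Poly_Mapping.keys x \<subseteq> {..<N} \<and> (\<forall>i. Poly_Mapping.lookup x i \<in> \<int>)}"

definition lattice_polytope :: "nat \<Rightarrow> (nat \<Rightarrow>\<^sub>0 real) set \<Rightarrow> bool" where
  "lattice_polytope N P \<longleftrightarrow> (\<exists>V. finite V \<and> V \<subseteq> lattice_points N UNIV \<and> P = convex hull V)"

definition normal_polytope :: "nat \<Rightarrow> (nat \<Rightarrow>\<^sub>0 real) set \<Rightarrow> bool" where
  "normal_polytope N P \<longleftrightarrow> lattice_polytope N P \<and>
     (\<forall>n\<ge>1. lattice_points N ((\<lambda>x. real n *\<^sub>R x) ` P) \<subseteq> minkowski_multiple n (lattice_points N P))"

definition real_exponent :: "exponent \<Rightarrow> nat \<Rightarrow>\<^sub>0 real" where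
  "real_exponent p = Poly_Mapping.map real p"

text \<open>For a favourable module all lattice points of the polytope are of this form.\<close>

definition lattice_exponents :: "nat \<Rightarrow> (nat \<Rightarrow>\<^sub>0 real) set \<Rightarrow> exponent set" where
  "lattice_exponents N P = {p \<in> exponents N. real_exponent p \<in> P}"

section \<open>Cyclic modules\<close>

text \<open>
  A module is given by the scalar multiplication \<open>scl\<close> of the underlying vector space, a Lie algebra
  \<open>\<gg>\<close> and its action \<open>act\<close>; \<open>cyclic_module scl \<gg> act v\<close> is the submodule \<open>U(\<gg>) v\<close>.
\<close>

definition cyclic_module ::
    "(complex \<Rightarrow> 'v \<Rightarrow> 'v) \<Rightarrow> 'g set \<Rightarrow> ('g \<Rightarrow> 'v \<Rightarrow> 'v) \<Rightarrow> 'v \<Rightarrow> 'v::ab_group_add set" where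
  "cyclic_module scl \<gg> act v = Modules.module.span scl {foldr act xs v |xs. set xs \<subseteq> \<gg>}"

definition degree_filtration ::
    "(complex \<Rightarrow> 'v \<Rightarrow> 'v) \<Rightarrow> 'g set \<Rightarrow> ('g \<Rightarrow> 'v \<Rightarrow> 'v) \<Rightarrow> 'v \<Rightarrow> nat \<Rightarrow> 'v::ab_group_add set" where
  "degree_filtration scl \<gg> act v s =
     Modules.module.span scl {foldr act xs v |xs. length xs \<le> s \<and> set xs \<subseteq> \<gg>}"

text \<open>\<open>monomial N T p v\<close> is \<open>T\<^sub>0\<^bsup>p 0\<^esup> (T\<^sub>1\<^bsup>p 1\<^esup> (\<dots> v))\<close>, where \<open>T\<^sub>i\<close> is the operator by which the
  \<open>i\<close>-th basis element acts.\<close>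

definition monomial :: "nat \<Rightarrow> (nat \<Rightarrow> 'v \<Rightarrow> 'v) \<Rightarrow> exponent \<Rightarrow> 'v \<Rightarrow> 'v" where
  "monomial N T p v = foldr (\<lambda>i. T i ^^ Poly_Mapping.lookup p i) [0..<N] v"

definition filtration_le ::
    "(complex \<Rightarrow> 'v \<Rightarrow> 'v) \<Rightarrow> nat \<Rightarrow> (exponent \<Rightarrow> exponent \<Rightarrow> bool) \<Rightarrow> (nat \<Rightarrow> 'v \<Rightarrow> 'v) \<Rightarrow> 'v \<Rightarrow>
     exponent \<Rightarrow> 'v::ab_group_add set" where
  "filtration_le scl N lt T v p =
     Modules.module.span scl {monomial N T q v |q. q \<in> exponents N \<and> (lt q p \<or> q = p)}"

definition filtration_less ::
    "(complex \<Rightarrow> 'v \<Rightarrow> 'v) \<Rightarrow> nat \<Rightarrow> (exponent \<Rightarrow> exponent \<Rightarrow> bool) \<Rightarrow> (nat \<Rightarrow> 'v \<Rightarrow> 'v) \<Rightarrow> 'v \<Rightarrow>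
     exponent \<Rightarrow> 'v::ab_group_add set" where
  "filtration_less scl N lt T v p =
     Modules.module.span scl {monomial N T q v |q. q \<in> exponents N \<and> lt q p}"

definition essential_exponents ::
    "(complex \<Rightarrow> 'v \<Rightarrow> 'v) \<Rightarrow> nat \<Rightarrow> (exponent \<Rightarrow> exponent \<Rightarrow> bool) \<Rightarrow> (nat \<Rightarrow> 'v \<Rightarrow> 'v) \<Rightarrow>
     'v::ab_group_add \<Rightarrow> exponent set" where
  "essential_exponents scl N lt T v =
     {p \<in> exponents N. monomial N T p v \<notin> filtration_less scl N lt T v p}"

section \<open>Graded spaces\<close>

definition complex_field :: "complex ring" where
  "complex_field = \<lparr>carrier = UNIV, monoid.mult = (*), one = 1, zero = 0, add = (+)\<rparr>"

lemma cring_complex_field: "cring complex_field"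
proof (rule cringI)
  show "abelian_group complex_field"
  proof (rule abelian_groupI)
    fix x :: complex assume "x \<in> carrier complex_field"
    show "\<exists>y\<in>carrier complex_field. y \<oplus>\<^bsub>complex_field\<^esub> x = \<zero>\<^bsub>complex_field\<^esub>"
      by (auto simp: complex_field_def intro: exI[of _ "-x"])
  qed (auto simp: complex_field_def)
  show "comm_monoid complex_field"
    by (rule comm_monoidI) (auto simp: complex_field_def)
qed (auto simp: complex_field_def algebra_simps)

text \<open>
  \<open>graded_space scl I F G\<close> is the direct sum of the quotients \<open>F i / G i\<close> over \<open>i \<in> I\<close>; its elements
  are finitely supported families of cosets.  The ring multiplication and unit
  that the module record inherits are irrelevant.
\<close>

definition graded_space ::
    "(complex \<Rightarrow> 'v \<Rightarrow> 'v) \<Rightarrow> 'i set \<Rightarrow> ('i \<Rightarrow> 'v set) \<Rightarrow> ('i \<Rightarrow> 'v::ab_group_add set) \<Rightarrow>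
     (complex, 'i \<Rightarrow> 'v set) module" where
  "graded_space scl I F G =
     \<lparr>carrier = {x \<in> \<Pi>\<^sub>E i\<in>I. {u +o G i |u. u \<in> F i}. finite {i \<in> I. x i \<noteq> G i}},
      monoid.mult = undefined, one = undefined,
      zero = (\<lambda>i\<in>I. G i),
      add = (\<lambda>x y. \<lambda>i\<in>I. x i + y i),
      smult = (\<lambda>c x. \<lambda>i\<in>I. scl c ` x i + G i)\<rparr>"

lemma module_graded_space:
  assumes "vector_space scl"
    and F: "\<And>i. i \<in> I \<Longrightarrow> Modules.module.subspace scl (F i)"
    and G: "\<And>i. i \<in> I \<Longrightarrow> Modules.module.subspace scl (G i)"
  shows "Module.module complex_field (graded_space scl I F G)"
proof -
  interpret vs: vector_space scl by fact
  let ?V = "graded_space scl I F G"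
  have GG: "(u +o G i) + (w +o G i) = (u + w) +o G i" if "i \<in> I" for i u w
  proof -
    have "G i + G i = G i"
      using G[OF that] vs.subspace_add vs.subspace_0
      by (auto simp: set_plus_def) (metis add.right_neutral)
    then show ?thesis by (simp add: set_plus_rearrange)
  qed
  have G0: "0 +o G i = G i" for i by simp
  have GS: "scl c ` (u +o G i) + G i = scl c u +o G i" if "i \<in> I" for i u c
  proof
    show "scl c ` (u +o G i) + G i \<subseteq> scl c u +o G i"
      using G[OF that] vs.subspace_add vs.subspace_scale
      by (auto simp: set_plus_def elt_set_plus_def vs.scale_right_distrib add.assoc)
    show "scl c u +o G i \<subseteq> scl c ` (u +o G i) + G i"
    proof
      fix x assume "x \<in> scl c u +o G i"
      then obtain g where g: "g \<in> G i" "x = scl c u + g" by (auto simp: elt_set_plus_def)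
      have "u \<in> u +o G i"
        using vs.subspace_0[OF G[OF that]] by (auto simp: elt_set_plus_def)
      then show "x \<in> scl c ` (u +o G i) + G i" using g by (blast intro: set_plus_intro)
    qed
  qed
  define cls where "cls u = (\<lambda>i\<in>I. u i +o G i)" for u
  define U where "U = {u. (\<forall>i\<in>I. u i \<in> F i) \<and> finite {i\<in>I. u i \<noteq> 0}}"
  have carr: "carrier ?V = cls ` U"
  proof
    show "cls ` U \<subseteq> carrier ?V"
    proof clarify
      fix u assume u: "u \<in> U"
      have "{i \<in> I. cls u i \<noteq> G i} \<subseteq> {i\<in>I. u i \<noteq> 0}" by (auto simp: cls_def)
      then have "finite {i \<in> I. cls u i \<noteq> G i}" using u finite_subset unfolding U_def by blast
      then show "cls u \<in> carrier ?V"
        using u by (auto simp: graded_space_def cls_def U_def)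
    qed
    show "carrier ?V \<subseteq> cls ` U"
    proof
      fix x assume x: "x \<in> carrier ?V"
      then have "\<forall>i\<in>I. \<exists>u. u \<in> F i \<and> x i = u +o G i" and ext: "x \<in> extensional I"
        and fin: "finite {i \<in> I. x i \<noteq> G i}"
        by (auto simp: graded_space_def PiE_def Pi_iff)
      then obtain u where u: "\<And>i. i \<in> I \<Longrightarrow> u i \<in> F i \<and> x i = u i +o G i" by metis
      define u' where "u' i = (if x i = G i then 0 else u i)" for i
      have "{i\<in>I. u' i \<noteq> 0} \<subseteq> {i \<in> I. x i \<noteq> G i}" by (auto simp: u'_def)
      then have "finite {i\<in>I. u' i \<noteq> 0}" using fin finite_subset by blast
      moreover have "u' i \<in> F i" if "i \<in> I" for i
        using u vs.subspace_0[OF F] that by (simp add: u'_def)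
      ultimately have "u' \<in> U" by (simp add: U_def)
      moreover have "x = cls u'"
        using u ext by (auto simp: cls_def u'_def fun_eq_iff extensional_def)
      ultimately show "x \<in> cls ` U" by blast
    qed
  qed
  have addc: "cls u \<oplus>\<^bsub>?V\<^esub> cls w = cls (\<lambda>i. u i + w i)" for u w
    by (auto simp: graded_space_def cls_def fun_eq_iff GG)
  have smc: "c \<odot>\<^bsub>?V\<^esub> cls u = cls (\<lambda>i. scl c (u i))" for c u
    by (auto simp: graded_space_def cls_def fun_eq_iff GS)
  have zc: "\<zero>\<^bsub>?V\<^esub> = cls (\<lambda>i. 0)"
    by (auto simp: graded_space_def cls_def fun_eq_iff)
  have Uadd: "(\<lambda>i. u i + w i) \<in> U" if "u \<in> U" "w \<in> U" for u w
  proof -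
    have "{i\<in>I. u i + w i \<noteq> 0} \<subseteq> {i\<in>I. u i \<noteq> 0} \<union> {i\<in>I. w i \<noteq> 0}" by auto
    then show ?thesis using that vs.subspace_add[OF F] unfolding U_def
      by (auto intro: finite_subset)
  qed
  have Usc: "(\<lambda>i. scl c (u i)) \<in> U" if "u \<in> U" for c u
  proof -
    have "{i\<in>I. scl c (u i) \<noteq> 0} \<subseteq> {i\<in>I. u i \<noteq> 0}" by auto
    then show ?thesis using that vs.subspace_scale[OF F] unfolding U_def
      by (auto intro: finite_subset)
  qed
  have U0: "(\<lambda>i. 0) \<in> U" using vs.subspace_0[OF F] by (auto simp: U_def)
  show ?thesis
  proof (rule moduleI)
    show "cring complex_field" by (rule cring_complex_field)
    show "abelian_group ?V"
    proof (rule abelian_groupI)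
      fix x assume "x \<in> carrier ?V"
      then obtain u where u: "u \<in> U" "x = cls u" by (auto simp: carr)
      have "cls (\<lambda>i. scl (-1) (u i)) \<oplus>\<^bsub>?V\<^esub> x = \<zero>\<^bsub>?V\<^esub>"
        by (simp add: u addc zc vs.scale_minus_left)
      then show "\<exists>y\<in>carrier ?V. y \<oplus>\<^bsub>?V\<^esub> x = \<zero>\<^bsub>?V\<^esub>"
        using Usc[OF u(1), of "-1"] by (auto simp: carr)
    qed (auto simp: carr addc zc Uadd U0 add_ac)
  qed (auto simp: carr addc smc zc Uadd Usc U0 complex_field_def
         vs.scale_left_distrib vs.scale_right_distrib)
qed

definition homogeneous_element ::
    "'i set \<Rightarrow> ('i \<Rightarrow> 'v::ab_group_add set) \<Rightarrow> 'i \<Rightarrow> 'v \<Rightarrow> 'i \<Rightarrow> 'v set" where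
  "homogeneous_element I G i u = (\<lambda>j\<in>I. if j = i then u +o G j else G j)"

definition module_basis :: "(complex, 'b) module \<Rightarrow> 'b set \<Rightarrow> bool" where
  "module_basis V B \<longleftrightarrow> B \<subseteq> carrier V \<and>
     (\<forall>x\<in>carrier V. \<exists>!a. a \<in> extensional B \<and> finite {b \<in> B. a b \<noteq> 0} \<and>
        x = finsum V (\<lambda>b. smult V (a b) b) {b \<in> B. a b \<noteq> 0})"

text \<open>The associated graded space of the degree filtration, with the convention \<open>L\<^sub>-\<^sub>1 = 0\<close>.\<close>

definition degree_filtration_less ::
    "(complex \<Rightarrow> 'v \<Rightarrow> 'v) \<Rightarrow> 'g set \<Rightarrow> ('g \<Rightarrow> 'v \<Rightarrow> 'v) \<Rightarrow> 'v \<Rightarrow> nat \<Rightarrow> 'v::ab_group_add set" where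
  "degree_filtration_less scl \<gg> act v s =
     (if s = 0 then {0} else degree_filtration scl \<gg> act v (s - 1))"

definition gr_a ::
    "(complex \<Rightarrow> 'v \<Rightarrow> 'v) \<Rightarrow> 'g set \<Rightarrow> ('g \<Rightarrow> 'v \<Rightarrow> 'v) \<Rightarrow> 'v::ab_group_add \<Rightarrow>
     (complex, nat \<Rightarrow> 'v set) module" where
  "gr_a scl \<gg> act v =
     graded_space scl UNIV (degree_filtration scl \<gg> act v) (degree_filtration_less scl \<gg> act v)"

definition gr_a_action ::
    "(complex \<Rightarrow> 'v \<Rightarrow> 'v) \<Rightarrow> 'g set \<Rightarrow> ('g \<Rightarrow> 'v \<Rightarrow> 'v) \<Rightarrow> 'v::ab_group_add \<Rightarrow>
     'g \<Rightarrow> (nat \<Rightarrow> 'v set) \<Rightarrow> (nat \<Rightarrow> 'v set)" where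
  "gr_a_action scl \<gg> act v X x =
     (\<lambda>s. if s = 0 then degree_filtration_less scl \<gg> act v s
          else act X ` x (s - 1) + degree_filtration_less scl \<gg> act v s)"

definition gr_a_generator ::
    "(complex \<Rightarrow> 'v \<Rightarrow> 'v) \<Rightarrow> 'g set \<Rightarrow> ('g \<Rightarrow> 'v \<Rightarrow> 'v) \<Rightarrow> 'v::ab_group_add \<Rightarrow> (nat \<Rightarrow> 'v set)" where
  "gr_a_generator scl \<gg> act v =
     homogeneous_element UNIV (degree_filtration_less scl \<gg> act v) 0 v"

text \<open>The associated graded space of the filtration by a monomial order.\<close>

definition gr_t ::
    "(complex \<Rightarrow> 'v \<Rightarrow> 'v) \<Rightarrow> nat \<Rightarrow> (exponent \<Rightarrow> exponent \<Rightarrow> bool) \<Rightarrow> (nat \<Rightarrow> 'v \<Rightarrow> 'v) \<Rightarrow>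
     'v::ab_group_add \<Rightarrow> (complex, exponent \<Rightarrow> 'v set) module" where
  "gr_t scl N lt T v =
     graded_space scl (exponents N) (filtration_le scl N lt T v) (filtration_less scl N lt T v)"

definition gr_t_action ::
    "(complex \<Rightarrow> 'v \<Rightarrow> 'v) \<Rightarrow> nat \<Rightarrow> (exponent \<Rightarrow> exponent \<Rightarrow> bool) \<Rightarrow> (nat \<Rightarrow> 'v \<Rightarrow> 'v) \<Rightarrow>
     'v::ab_group_add \<Rightarrow> nat \<Rightarrow> (exponent \<Rightarrow> 'v set) \<Rightarrow> (exponent \<Rightarrow> 'v set)" where
  "gr_t_action scl N lt T v i x =
     (\<lambda>p\<in>exponents N. if Poly_Mapping.lookup p i = 0 then filtration_less scl N lt T v p
        else T i ` x (p - Poly_Mapping.single i 1) + filtration_less scl N lt T v p)"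

definition gr_t_generator ::
    "(complex \<Rightarrow> 'v \<Rightarrow> 'v) \<Rightarrow> nat \<Rightarrow> (exponent \<Rightarrow> exponent \<Rightarrow> bool) \<Rightarrow> (nat \<Rightarrow> 'v \<Rightarrow> 'v) \<Rightarrow>
     'v::ab_group_add \<Rightarrow> (exponent \<Rightarrow> 'v set)" where
  "gr_t_generator scl N lt T v = homogeneous_element (exponents N) (filtration_less scl N lt T v) 0 v"

section \<open>Favourable modules\<close>

definition cartan_component ::
    "(complex^'m^'m) set \<Rightarrow> (complex^'m^'m \<Rightarrow> complex^'d^'d) \<Rightarrow> complex^'d \<Rightarrow> nat \<Rightarrow> 'd tensor set" where
  "cartan_component U \<rho> v n =
     cyclic_module tensor_scale (lie_algebra U) (lie_tensor_action U \<rho>) (tensor_power_vector n v)"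

definition favourable_wrt ::
    "(complex^'m^'m) set \<Rightarrow> (complex^'m^'m \<Rightarrow> complex^'d^'d) \<Rightarrow> complex^'d \<Rightarrow>
     nat \<Rightarrow> (nat \<Rightarrow> complex^'m^'m) \<Rightarrow> (exponent \<Rightarrow> exponent \<Rightarrow> bool) \<Rightarrow> (nat \<Rightarrow>\<^sub>0 real) set \<Rightarrow> bool" where
  "favourable_wrt U \<rho> v N f lt P \<longleftrightarrow>
     ordered_basis N f (lie_algebra U) \<and> homogeneous_monomial_order N lt \<and>
     normal_polytope N P \<and>
     lattice_points N P =
       real_exponent ` essential_exponents (*s) N lt (\<lambda>i. lie_action U \<rho> (f i)) v \<and>
     (\<forall>n\<ge>1. vector_space.dim tensor_scale (cartan_component U \<rho> v n)
             = card (minkowski_multiple n (lattice_exponents N P)))"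

end

theory Submission
  imports Defs
begin

text \<open>
  Write \<open>S\<close> for the set of lattice points of the polytope, that is, the set of essential exponents
  of \<open>M\<close>.  The heart of the matter is the inclusion \<open>nS \<subseteq> es(M\<^sup>\<odot>\<^sup>n)\<close>.  It follows from the
  additivity of essential exponents: if \<open>p\<close> is essential for \<open>v\<close> and \<open>p'\<close> for \<open>w\<close>, choose linear
  functionals \<open>\<phi>\<close> and \<open>\<Phi>\<close> that detect \<open>f\<^sup>p v\<close> and \<open>f\<^sup>p\<^sup>' w\<close> but vanish on all smaller monomials.  By
  the Leibniz rule, \<open>f\<^sup>q (v \<otimes> w)\<close> is a sum of tensors \<open>f\<^sup>a v \<otimes> f\<^sup>c w\<close> with \<open>a + c = q\<close>, and
  \<open>\<phi> \<otimes> \<Phi>\<close> kills those with \<open>a < p\<close> or \<open>c < p'\<close>.  Compatibility of the order with addition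
  therefore leaves nothing for \<open>q < p + p'\<close>, and for \<open>q = p + p'\<close> a positive multiple of
  \<open>\<phi> (f\<^sup>p v) \<Phi> (f\<^sup>p\<^sup>' w)\<close>; so \<open>p + p'\<close> is essential (\<open>dual_functional_tensor_cons\<close>).  Monomials
  are handled as sorted words, so that the terms of the Leibniz rule are the splittings of a word
  into two subwords and no binomial coefficient has to be computed.

  Essential monomials are linearly independent, and since \<open>dim M\<^sup>\<odot>\<^sup>n = card (nS)\<close> there is no room for
  others: \<open>nS = es(M\<^sup>\<odot>\<^sup>n)\<close>, and the corresponding monomials form a basis
  (\<open>essential_exponents_eq\<close>).  This uses that the ordered monomials span \<open>U(\<gg>) v\<close>, the easy half of
  the theorem of Poincare, Birkhoff and Witt.  It rests on two facts about algebraic groups, obtained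
  by differentiating polynomial identities twice: the tangent space at the identity is closed under
  the commutator, and the differential of a representation preserves commutators.

  For the graded versions, the essential monomials of degree at most \<open>s\<close> (respectively of exponent
  at most \<open>p\<close>) span the corresponding step of the filtration, because an inessential monomial is a
  combination of smaller essential ones and smaller monomials have no larger degree.  A basis that
  is adapted to a filtration in this way yields a homogeneous basis of the graded space
  (\<open>graded_space_basis\<close>), and the action of \<open>S(\<gg>)\<close> on the class of the generator gives precisely
  these classes (\<open>gr_a_monomial\<close>, \<open>gr_t_monomial\<close>).
\<close>

section \<open>Left-invariant derivatives of polynomials\<close>

lemma matrix_polynomial_sum:
  "(\<And>k. k \<in> K \<Longrightarrow> matrix_polynomial (p k)) \<Longrightarrow> matrix_polynomial (\<lambda>g. \<Sum>k\<in>K. p k g)"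
  by (induction K rule: infinite_finite_induct)
    (simp_all add: matrix_polynomial.const matrix_polynomial.add)

lemma matrix_polynomial_diff:
  assumes "matrix_polynomial p" "matrix_polynomial q"
  shows "matrix_polynomial (\<lambda>g. p g - q g)"
  using matrix_polynomial.add[OF assms(1) matrix_polynomial.mult[OF matrix_polynomial.const[of "-1"] assms(2)]]
  by simp

lemma matrix_polynomial_entry_mult:
  "matrix_polynomial (\<lambda>h. (g ** h) $ i $ j)" "matrix_polynomial (\<lambda>h. (h ** g) $ i $ j)"
  by (auto simp: matrix_matrix_mult_def
      intro!: matrix_polynomial_sum matrix_polynomial.intros)

lemma matrix_polynomial_left_translate:
  "matrix_polynomial p \<Longrightarrow> matrix_polynomial (\<lambda>h. p (g ** h))"
  by (induction rule: matrix_polynomial.induct)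
    (auto intro: matrix_polynomial.intros matrix_polynomial_entry_mult)

lemma derivative_at_one_const: "derivative_at_one (\<lambda>g. c) X 0"
  by (simp add: derivative_at_one_def)

lemma derivative_at_one_add:
  "derivative_at_one p X a \<Longrightarrow> derivative_at_one q X b \<Longrightarrow> derivative_at_one (\<lambda>g. p g + q g) X (a + b)"
  unfolding derivative_at_one_def by (rule DERIV_add)

lemma derivative_at_one_diff:
  "derivative_at_one p X a \<Longrightarrow> derivative_at_one q X b \<Longrightarrow> derivative_at_one (\<lambda>g. p g - q g) X (a - b)"
  unfolding derivative_at_one_def by (rule DERIV_diff)

lemma matrix_scale_0 [simp]: "matrix_scale 0 X = 0"
  by (simp add: matrix_scale_def vec_eq_iff)

lemma derivative_at_one_mult:
  assumes "derivative_at_one p X a" "derivative_at_one q X b"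
  shows "derivative_at_one (\<lambda>g. p g * q g) X (a * q (mat 1) + p (mat 1) * b)"
  using DERIV_mult[OF assms[unfolded derivative_at_one_def]]
  by (simp add: derivative_at_one_def algebra_simps)

lemma derivative_at_one_cmult:
  "derivative_at_one p X a \<Longrightarrow> derivative_at_one (\<lambda>g. c * p g) X (c * a)"
  using derivative_at_one_mult[OF derivative_at_one_const] by fastforce

lemma derivative_at_one_sum:
  "(\<And>k. k \<in> K \<Longrightarrow> derivative_at_one (p k) X (a k)) \<Longrightarrow>
    derivative_at_one (\<lambda>g. \<Sum>k\<in>K. p k g) X (\<Sum>k\<in>K. a k)"
  by (induction K rule: infinite_finite_induct)
    (simp_all add: derivative_at_one_const derivative_at_one_add)

lemma derivative_at_one_unique:
  "derivative_at_one p X a \<Longrightarrow> derivative_at_one p X b \<Longrightarrow> a = b"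
  unfolding derivative_at_one_def by (rule DERIV_unique)

definition lie_bracket :: "complex^'m^'m \<Rightarrow> complex^'m^'m \<Rightarrow> complex^'m^'m" where
  "lie_bracket X Y = X ** Y - Y ** X"

lemma matrix_add_rdistrib: "((A + B) :: complex^'m^'m) ** C = A ** C + B ** C"
  by (simp add: vec_eq_iff matrix_matrix_mult_def distrib_right sum.distrib)

lemma matrix_mult_scale_right: "A ** matrix_scale c B = matrix_scale c (A ** B)"
  by (simp add: vec_eq_iff matrix_matrix_mult_def matrix_scale_def sum_distrib_left mult_ac)

lemma matrix_mult_scale_left: "matrix_scale c A ** B = matrix_scale c (A ** B)"
  by (simp add: vec_eq_iff matrix_matrix_mult_def matrix_scale_def sum_distrib_left mult_ac)

lemma matrix_scale_entry: "matrix_scale c A $ i $ j = c * A $ i $ j"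
  by (simp add: matrix_scale_def)

text \<open>
  \<open>L g Y\<close> is the derivative of \<open>p\<close> along the left-invariant vector field of \<open>Y\<close> at \<open>g\<close>, and
  \<open>E X Y\<close> is the derivative of \<open>\<lambda>g. L g Y\<close> at the identity along \<open>X\<close>, that is
  \<open>d\<^sup>2p (X, Y) + dp (X ** Y)\<close>.  Since second derivatives are symmetric, the antisymmetric part
  of \<open>E\<close> is a first derivative.
\<close>

definition left_derivatives ::
    "(complex^'m^'m \<Rightarrow> complex) \<Rightarrow> (complex^'m^'m \<Rightarrow> complex^'m^'m \<Rightarrow> complex) \<Rightarrow>
     (complex^'m^'m \<Rightarrow> complex^'m^'m \<Rightarrow> complex) \<Rightarrow> bool" where
  "left_derivatives p L E \<longleftrightarrow>
     (\<forall>Y. matrix_polynomial (\<lambda>g. L g Y)) \<and>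
     (\<forall>g Y. derivative_at_one (\<lambda>h. p (g ** h)) Y (L g Y)) \<and>
     (\<forall>X Y. derivative_at_one (\<lambda>g. L g Y) X (E X Y)) \<and>
     (\<forall>X Y. E X Y - E Y X = L (mat 1) (lie_bracket X Y)) \<and>
     (\<forall>g X Y. L g (X + Y) = L g X + L g Y) \<and>
     (\<forall>g c X. L g (matrix_scale c X) = c * L g X)"

lemma left_derivativesD:
  assumes "left_derivatives p L E"
  shows "matrix_polynomial (\<lambda>g. L g Y)"
    "derivative_at_one (\<lambda>h. p (g ** h)) Y (L g Y)"
    "derivative_at_one p Y (L (mat 1) Y)"
    "derivative_at_one (\<lambda>g. L g Y) X (E X Y)"
    "E X Y - E Y X = L (mat 1) (lie_bracket X Y)"
    "L g (X + Y) = L g X + L g Y"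
    "L g (matrix_scale c X) = c * L g X"
proof -
  have *: "derivative_at_one (\<lambda>h. p (g ** h)) Y (L g Y)" for g Y
    using assms by (simp add: left_derivatives_def)
  show "derivative_at_one (\<lambda>h. p (g ** h)) Y (L g Y)" "derivative_at_one p Y (L (mat 1) Y)"
    using *[of g Y] *[of "mat 1" Y] by simp_all
qed (use assms in \<open>simp_all add: left_derivatives_def\<close>)

text \<open>The product rule carries the identities from the matrix entries to all polynomials.\<close>

lemma left_derivatives_exist:
  fixes p :: "complex^'m^'m \<Rightarrow> complex"
  assumes "matrix_polynomial p"
  obtains L E where "left_derivatives p L E"
proof -
  have "\<exists>L E. left_derivatives p L E"
    using assms
  proof (induction rule: matrix_polynomial.induct)
    case (const c)
    show ?case
      by (intro exI[of _ "\<lambda>_ _. 0"])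
        (simp add: left_derivatives_def matrix_polynomial.const derivative_at_one_const)
  next
    case (entry i j)
    have "((\<lambda>t. (g ** (mat 1 + matrix_scale t Y)) $ i $ j) has_field_derivative (g ** Y) $ i $ j) (at 0)"
      for g Y :: "complex^'m^'m"
      by (auto simp: matrix_add_ldistrib matrix_mult_scale_right matrix_scale_entry
          intro!: derivative_eq_intros)
    moreover have "((\<lambda>t. ((mat 1 + matrix_scale t X) ** Y) $ i $ j) has_field_derivative (X ** Y) $ i $ j) (at 0)"
      for X Y :: "complex^'m^'m"
      by (auto simp: matrix_add_rdistrib matrix_mult_scale_left matrix_scale_entry
          intro!: derivative_eq_intros)
    ultimately show ?case
      by (intro exI[of _ "\<lambda>g Y. (g ** Y) $ i $ j"])
        (simp add: left_derivatives_def derivative_at_one_def matrix_polynomial_entry_mult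
          lie_bracket_def matrix_add_ldistrib matrix_mult_scale_right matrix_scale_entry)
  next
    case (add p q)
    then obtain L E L' E' where "left_derivatives p L E" "left_derivatives q L' E'"
      by blast
    note p = left_derivativesD[OF this(1)] and q = left_derivativesD[OF this(2)]
    have "(E X Y + E' X Y) - (E Y X + E' Y X)
        = L (mat 1) (lie_bracket X Y) + L' (mat 1) (lie_bracket X Y)" for X Y
      by (simp add: p(5)[symmetric] q(5)[symmetric])
    then have "left_derivatives (\<lambda>g. p g + q g) (\<lambda>g Y. L g Y + L' g Y) (\<lambda>X Y. E X Y + E' X Y)"
      unfolding left_derivatives_def
      using p(1,2,4) q(1,2,4)
      by (simp add: matrix_polynomial.add derivative_at_one_add p(6,7) q(6,7) distrib_left)
    then show ?case by blast
  next
    case (mult p q)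
    then obtain L E L' E' where "left_derivatives p L E" "left_derivatives q L' E'"
      by blast
    note p = left_derivativesD[OF this(1)] and q = left_derivativesD[OF this(2)]
    let ?L = "\<lambda>g Y. L g Y * q g + p g * L' g Y"
    let ?E = "\<lambda>X Y. (E X Y * q (mat 1) + L (mat 1) Y * L' (mat 1) X)
        + (L (mat 1) X * L' (mat 1) Y + p (mat 1) * E' X Y)"
    have "derivative_at_one (\<lambda>h. p (g ** h) * q (g ** h)) Y (?L g Y)" for g Y
      using derivative_at_one_mult[OF p(2) q(2)] by simp
    moreover have "matrix_polynomial (\<lambda>g. ?L g Y)" for Y
      using p(1) q(1) mult.hyps by (intro matrix_polynomial.intros)
    moreover have "derivative_at_one (\<lambda>g. ?L g Y) X (?E X Y)" for X Y
      using p(3,4) q(3,4) by (intro derivative_at_one_add derivative_at_one_mult)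
    moreover have "?E X Y - ?E Y X = ?L (mat 1) (lie_bracket X Y)" for X Y
      by (simp add: p(5)[symmetric] q(5)[symmetric] algebra_simps)
    moreover have "?L g (X + Y) = ?L g X + ?L g Y" "?L g (matrix_scale c X) = c * ?L g X" for g X Y c
      by (simp_all add: p(6,7) q(6,7) algebra_simps)
    ultimately show ?case
      unfolding left_derivatives_def by (intro exI[of _ ?L] exI[of _ ?E]) blast
  qed
  then show ?thesis using that by blast
qed

lemma derivative_at_one_exists:
  assumes "matrix_polynomial p"
  obtains c where "derivative_at_one p X c"
proof -
  obtain L E where "left_derivatives p L E" using left_derivatives_exist[OF assms] .
  then show ?thesis using left_derivativesD(3) that by blast
qed

lemma derivative_at_one_vec_add:
  assumes p: "matrix_polynomial p" and X: "derivative_at_one p X a" and Y: "derivative_at_one p Y b"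
  shows "derivative_at_one p (X + Y) (a + b)"
proof -
  obtain L E where "left_derivatives p L E" using left_derivatives_exist[OF p] .
  note L = left_derivativesD[OF this]
  have "a = L (mat 1) X" "b = L (mat 1) Y"
    using X Y L(3) by (auto intro: derivative_at_one_unique)
  then show ?thesis using L(3)[of "X + Y"] by (simp add: L(6))
qed

lemma derivative_at_one_vec_scale:
  assumes p: "matrix_polynomial p" and X: "derivative_at_one p X a"
  shows "derivative_at_one p (matrix_scale c X) (c * a)"
proof -
  obtain L E where "left_derivatives p L E" using left_derivatives_exist[OF p] .
  note L = left_derivativesD[OF this]
  have "a = L (mat 1) X" using X L(3) by (rule derivative_at_one_unique)
  then show ?thesis using L(3)[of "matrix_scale c X"] by (simp add: L(7))
qed

section \<open>The Lie algebra and its representation\<close>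

lemma lie_algebra_derivative_eq:
  assumes "X \<in> lie_algebra U" "matrix_polynomial p" "matrix_polynomial q"
    and "\<And>g. g \<in> U \<Longrightarrow> p g = q g"
    and "derivative_at_one p X a" "derivative_at_one q X b"
  shows "a = b"
proof -
  have "derivative_at_one (\<lambda>g. p g - q g) X 0"
    using assms matrix_polynomial_diff[OF assms(2,3)] by (auto simp: lie_algebra_def)
  then show ?thesis
    using derivative_at_one_unique[OF derivative_at_one_diff[OF assms(5,6)]] by fastforce
qed

lemma lie_algebra_add: "X \<in> lie_algebra U \<Longrightarrow> Y \<in> lie_algebra U \<Longrightarrow> X + Y \<in> lie_algebra U"
  using derivative_at_one_vec_add by (fastforce simp: lie_algebra_def)

lemma lie_algebra_scale: "X \<in> lie_algebra U \<Longrightarrow> matrix_scale c X \<in> lie_algebra U"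
  using derivative_at_one_vec_scale by (fastforce simp: lie_algebra_def)

lemma differential_entry:
  assumes "X \<in> lie_algebra U" "matrix_polynomial p" "\<And>g. g \<in> U \<Longrightarrow> \<rho> g $ i $ j = p g"
    "derivative_at_one p X c"
  shows "differential U \<rho> X $ i $ j = c"
proof -
  have "(THE c. \<exists>p. matrix_polynomial p \<and> (\<forall>g\<in>U. \<rho> g $ i $ j = p g) \<and> derivative_at_one p X c) = c"
  proof (rule the_equality)
    show "\<exists>p. matrix_polynomial p \<and> (\<forall>g\<in>U. \<rho> g $ i $ j = p g) \<and> derivative_at_one p X c"
      using assms by blast
    fix c' assume "\<exists>p. matrix_polynomial p \<and> (\<forall>g\<in>U. \<rho> g $ i $ j = p g) \<and> derivative_at_one p X c'"
    then show "c' = c" using lie_algebra_derivative_eq[OF assms(1)] assms by metis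
  qed
  then show ?thesis by (simp add: differential_def)
qed

text \<open>
  Multiplicativity of \<open>\<rho>\<close> is differentiated twice: in the right factor along \<open>Y\<close> at every
  \<open>g \<in> U\<close>, which is an identity between polynomials in \<open>g\<close> on \<open>U\<close>, and then at the identity
  along \<open>X\<close>.  Read for the zero function in place of the coefficients of \<open>\<rho>\<close>, the same computation
  shows that the tangent space is closed under the bracket.
\<close>

lemma second_derivative_of_multiplicative:
  fixes p :: "complex^'m^'m \<Rightarrow> complex" and q r :: "'k::finite \<Rightarrow> complex^'m^'m \<Rightarrow> complex"
  assumes U: "\<And>g h. g \<in> U \<Longrightarrow> h \<in> U \<Longrightarrow> g ** h \<in> U"
    and p: "matrix_polynomial p" and q: "\<And>k. matrix_polynomial (q k)" and r: "\<And>k. matrix_polynomial (r k)"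
    and mult: "\<And>g h. g \<in> U \<Longrightarrow> h \<in> U \<Longrightarrow> p (g ** h) = (\<Sum>k\<in>UNIV. q k g * r k h)"
    and X: "X \<in> lie_algebra U" and Y: "Y \<in> lie_algebra U"
    and qX: "\<And>k. derivative_at_one (q k) X (qX k)" and qY: "\<And>k. derivative_at_one (q k) Y (qY k)"
    and rX: "\<And>k. derivative_at_one (r k) X (rX k)" and rY: "\<And>k. derivative_at_one (r k) Y (rY k)"
  shows "derivative_at_one p (lie_bracket X Y) (\<Sum>k\<in>UNIV. qX k * rY k - qY k * rX k)"
proof -
  obtain L E where "left_derivatives p L E"
    using left_derivatives_exist[OF p] .
  note L = left_derivativesD[OF this]
  have E: "E A B = (\<Sum>k\<in>UNIV. qA k * rB k)"
    if AB: "A \<in> lie_algebra U" "B \<in> lie_algebra U"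
      and qA: "\<And>k. derivative_at_one (q k) A (qA k)" and rB: "\<And>k. derivative_at_one (r k) B (rB k)"
    for A B qA rB
  proof -
    have LB: "L g B = (\<Sum>k\<in>UNIV. rB k * q k g)" if g: "g \<in> U" for g
    proof (rule lie_algebra_derivative_eq[OF AB(2) matrix_polynomial_left_translate[OF p, of g]])
      show "matrix_polynomial (\<lambda>h. \<Sum>k\<in>UNIV. q k g * r k h)"
        by (intro matrix_polynomial_sum matrix_polynomial.mult matrix_polynomial.const r)
      have "derivative_at_one (\<lambda>h. \<Sum>k\<in>UNIV. q k g * r k h) B (\<Sum>k\<in>UNIV. q k g * rB k)"
        by (intro derivative_at_one_sum derivative_at_one_cmult rB)
      then show "derivative_at_one (\<lambda>h. \<Sum>k\<in>UNIV. q k g * r k h) B (\<Sum>k\<in>UNIV. rB k * q k g)"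
        by (simp add: mult.commute)
    qed (use mult g L in auto)
    have "E A B = (\<Sum>k\<in>UNIV. rB k * qA k)"
    proof (rule lie_algebra_derivative_eq[OF AB(1) L(1)[of B] _ LB L(4)])
      show "matrix_polynomial (\<lambda>g. \<Sum>k\<in>UNIV. rB k * q k g)"
        by (intro matrix_polynomial_sum matrix_polynomial.mult matrix_polynomial.const q)
      show "derivative_at_one (\<lambda>g. \<Sum>k\<in>UNIV. rB k * q k g) A (\<Sum>k\<in>UNIV. rB k * qA k)"
        by (intro derivative_at_one_sum derivative_at_one_cmult qA)
    qed
    then show ?thesis by (simp add: mult.commute)
  qed
  have "L (mat 1) (lie_bracket X Y) = (\<Sum>k\<in>UNIV. qX k * rY k - qY k * rX k)"
    by (simp add: L(5)[symmetric] E[OF X Y qX rY] E[OF Y X qY rX] sum_subtractf)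
  then show ?thesis using L(3)[of "lie_bracket X Y"] by simp
qed

lemma lie_algebra_bracket:
  assumes U: "\<And>g h. g \<in> U \<Longrightarrow> h \<in> U \<Longrightarrow> g ** h \<in> U"
    and "X \<in> lie_algebra U" "Y \<in> lie_algebra U"
  shows "lie_bracket X Y \<in> lie_algebra U"
proof -
  have "derivative_at_one p (lie_bracket X Y) 0"
    if "matrix_polynomial p" "\<forall>g\<in>U. p g = 0" for p
    using second_derivative_of_multiplicative[of U p "\<lambda>k::unit. \<lambda>g. 0" "\<lambda>k::unit. \<lambda>g. 0" X Y
        "\<lambda>_. 0" "\<lambda>_. 0" "\<lambda>_. 0" "\<lambda>_. 0"] that assms
    by (simp add: matrix_polynomial.const derivative_at_one_const)
  then show ?thesis by (simp add: lie_algebra_def)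
qed

lemma rational_representation_coefficients:
  assumes "rational_representation U \<rho>"
  obtains p where "\<And>i j. matrix_polynomial (p i j)" "\<And>i j g. g \<in> U \<Longrightarrow> \<rho> g $ i $ j = p i j g"
  using assms unfolding rational_representation_def by metis

lemma differential_derivative:
  assumes "X \<in> lie_algebra U" "matrix_polynomial p" "\<And>g. g \<in> U \<Longrightarrow> \<rho> g $ i $ j = p g"
  shows "derivative_at_one p X (differential U \<rho> X $ i $ j)"
  by (metis assms derivative_at_one_exists differential_entry)

lemma differential_add:
  assumes "rational_representation U \<rho>" "X \<in> lie_algebra U" "Y \<in> lie_algebra U"
  shows "differential U \<rho> (X + Y) = differential U \<rho> X + differential U \<rho> Y"
proof -
  obtain p where p: "\<And>i j. matrix_polynomial (p i j)" "\<And>i j g. g \<in> U \<Longrightarrow> \<rho> g $ i $ j = p i j g"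
    using rational_representation_coefficients[OF assms(1)] by metis
  have "differential U \<rho> (X + Y) $ i $ j = differential U \<rho> X $ i $ j + differential U \<rho> Y $ i $ j" for i j
    using assms p by (intro differential_entry[OF _ p(1)[of i j] p(2)] lie_algebra_add
        derivative_at_one_vec_add differential_derivative) auto
  then show ?thesis by (simp add: vec_eq_iff)
qed

lemma differential_scale:
  assumes "rational_representation U \<rho>" "X \<in> lie_algebra U"
  shows "differential U \<rho> (matrix_scale c X) = matrix_scale c (differential U \<rho> X)"
proof -
  obtain p where p: "\<And>i j. matrix_polynomial (p i j)" "\<And>i j g. g \<in> U \<Longrightarrow> \<rho> g $ i $ j = p i j g"
    using rational_representation_coefficients[OF assms(1)] by metis
  have "differential U \<rho> (matrix_scale c X) $ i $ j = c * differential U \<rho> X $ i $ j" for i j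
    using assms p by (intro differential_entry[OF _ p(1)[of i j] p(2)] lie_algebra_scale
        derivative_at_one_vec_scale differential_derivative) auto
  then show ?thesis by (simp add: vec_eq_iff matrix_scale_entry)
qed

lemma differential_bracket:
  assumes U: "\<And>g h. g \<in> U \<Longrightarrow> h \<in> U \<Longrightarrow> g ** h \<in> U"
    and \<rho>: "rational_representation U \<rho>" and X: "X \<in> lie_algebra U" and Y: "Y \<in> lie_algebra U"
  shows "differential U \<rho> (lie_bracket X Y) = lie_bracket (differential U \<rho> X) (differential U \<rho> Y)"
proof -
  obtain p where p: "\<And>i j. matrix_polynomial (p i j)" "\<And>i j g. g \<in> U \<Longrightarrow> \<rho> g $ i $ j = p i j g"
    using rational_representation_coefficients[OF \<rho>] by metis
  let ?D = "differential U \<rho>"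
  have mult: "p i j (g ** h) = (\<Sum>k\<in>UNIV. p i k g * p k j h)" if "g \<in> U" "h \<in> U" for g h i j
  proof -
    have "\<rho> (g ** h) = \<rho> g ** \<rho> h" using \<rho> that by (simp add: rational_representation_def)
    then show ?thesis
      using that U by (simp add: p(2)[symmetric] matrix_matrix_mult_def)
  qed
  have D: "derivative_at_one (p i j) Z (?D Z $ i $ j)" if "Z \<in> lie_algebra U" for i j Z
    using differential_derivative[OF that p(1), of \<rho>] p(2) by blast
  have "?D (lie_bracket X Y) $ i $ j = (\<Sum>k\<in>UNIV. ?D X $ i $ k * ?D Y $ k $ j - ?D Y $ i $ k * ?D X $ k $ j)"
    for i j
    by (rule differential_entry[OF lie_algebra_bracket[OF U X Y] p(1) p(2)
      second_derivative_of_multiplicative[OF U p(1) p(1) p(1) mult X Y]]) (use D X Y in auto)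
  then show ?thesis
    by (simp add: vec_eq_iff lie_bracket_def matrix_matrix_mult_def sum_subtractf)
qed

section \<open>The action on tensors\<close>

lemma tensor_action_add: "tensor_action A (S + T) = tensor_action A S + tensor_action A T"
  by (simp add: tensor_action_def fun_eq_iff distrib_left sum.distrib)

lemma tensor_action_scale: "tensor_action A (tensor_scale c T) = tensor_scale c (tensor_action A T)"
  by (simp add: tensor_action_def tensor_scale_def fun_eq_iff sum_distrib_left mult_ac)

lemma tensor_action_matrix_add: "tensor_action (A + B) T = tensor_action A T + tensor_action B T"
  by (simp add: tensor_action_def fun_eq_iff distrib_right sum.distrib)

lemma tensor_action_matrix_scale: "tensor_action (matrix_scale c A) T = tensor_scale c (tensor_action A T)"
  by (simp add: tensor_action_def tensor_scale_def matrix_scale_entry fun_eq_iff sum_distrib_left mult_ac)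

text \<open>
  The composition of two actions splits into the terms where both matrices act in the same tensor
  factor and the terms where they act in different factors; the latter are symmetric.
\<close>

lemma tensor_action_bracket:
  "tensor_action A (tensor_action B T) - tensor_action B (tensor_action A T)
    = tensor_action (lie_bracket A B) T"
proof
  fix w :: "'a list"
  let ?n = "length w"
  define same where "same A B = (\<Sum>k<?n. \<Sum>i\<in>UNIV. (A ** B) $ (w ! k) $ i * T (w[k := i]))"
    for A B :: "complex^'a^'a"
  define diff where "diff A B = (\<Sum>k<?n. \<Sum>l\<in>{..<?n} - {k}. \<Sum>j\<in>UNIV. \<Sum>i\<in>UNIV.
      A $ (w ! k) $ j * B $ (w ! l) $ i * T (w[k := j, l := i]))" for A B :: "complex^'a^'a"
  have comp: "tensor_action A (tensor_action B T) w = same A B + diff A B" for A B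
  proof -
    let ?t = "\<lambda>k l. \<Sum>j\<in>UNIV. \<Sum>i\<in>UNIV. A $ (w ! k) $ j * B $ (w[k := j] ! l) $ i * T (w[k := j, l := i])"
    have "tensor_action A (tensor_action B T) w = (\<Sum>k<?n. \<Sum>l<?n. ?t k l)"
      by (simp add: tensor_action_def sum_distrib_left mult.assoc sum.swap[of _ UNIV "{..<?n}"])
    also have "\<dots> = (\<Sum>k<?n. ?t k k + (\<Sum>l\<in>{..<?n} - {k}. ?t k l))"
      by (intro sum.cong refl sum.remove) auto
    also have "\<dots> = (\<Sum>k<?n. ?t k k) + (\<Sum>k<?n. \<Sum>l\<in>{..<?n} - {k}. ?t k l)"
      by (rule sum.distrib)
    also have "(\<Sum>k<?n. ?t k k) = same A B"
    proof -
      have "?t k k = (\<Sum>i\<in>UNIV. (A ** B) $ (w ! k) $ i * T (w[k := i]))" if "k < ?n" for k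
      proof -
        have "?t k k = (\<Sum>j\<in>UNIV. \<Sum>i\<in>UNIV. A $ (w ! k) $ j * B $ j $ i * T (w[k := i]))"
          using that by simp
        also have "\<dots> = (\<Sum>i\<in>UNIV. \<Sum>j\<in>UNIV. A $ (w ! k) $ j * B $ j $ i * T (w[k := i]))"
          by (rule sum.swap)
        finally show ?thesis by (simp add: matrix_matrix_mult_def sum_distrib_right)
      qed
      then show ?thesis by (simp add: same_def)
    qed
    also have "(\<Sum>k<?n. \<Sum>l\<in>{..<?n} - {k}. ?t k l) = diff A B"
      by (auto simp: diff_def intro!: sum.cong)
    finally show ?thesis .
  qed
  have "diff A B = (\<Sum>(k, l)\<in>(SIGMA k:{..<?n}. {..<?n} - {k}). \<Sum>j\<in>UNIV. \<Sum>i\<in>UNIV.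
      A $ (w ! k) $ j * B $ (w ! l) $ i * T (w[k := j, l := i]))"
    unfolding diff_def by (rule sum.Sigma) auto
  also have "\<dots> = (\<Sum>(l, k)\<in>(SIGMA l:{..<?n}. {..<?n} - {l}). \<Sum>j\<in>UNIV. \<Sum>i\<in>UNIV.
      A $ (w ! k) $ j * B $ (w ! l) $ i * T (w[k := j, l := i]))"
    by (rule sum.reindex_bij_witness[of _ "\<lambda>(k, l). (l, k)" "\<lambda>(k, l). (l, k)"]) auto
  also have "\<dots> = (\<Sum>l<?n. \<Sum>k\<in>{..<?n} - {l}. \<Sum>j\<in>UNIV. \<Sum>i\<in>UNIV.
      A $ (w ! k) $ j * B $ (w ! l) $ i * T (w[k := j, l := i]))"
    by (rule sum.Sigma[symmetric]) auto
  also have "\<dots> = diff B A"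
    unfolding diff_def
  proof (rule sum.cong[OF refl], rule sum.cong[OF refl])
    fix l k assume lk: "l \<in> {..<?n}" "k \<in> {..<?n} - {l}"
    have "(\<Sum>j\<in>UNIV. \<Sum>i\<in>UNIV. A $ (w ! k) $ j * B $ (w ! l) $ i * T (w[k := j, l := i]))
      = (\<Sum>i\<in>UNIV. \<Sum>j\<in>UNIV. A $ (w ! k) $ j * B $ (w ! l) $ i * T (w[k := j, l := i]))"
      by (rule sum.swap)
    also have "\<dots> = (\<Sum>i\<in>UNIV. \<Sum>j\<in>UNIV. B $ (w ! l) $ i * A $ (w ! k) $ j * T (w[l := i, k := j]))"
      using lk by (intro sum.cong refl) (simp add: list_update_swap mult.commute)
    finally show "(\<Sum>j\<in>UNIV. \<Sum>i\<in>UNIV. A $ (w ! k) $ j * B $ (w ! l) $ i * T (w[k := j, l := i]))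
      = (\<Sum>i\<in>UNIV. \<Sum>j\<in>UNIV. B $ (w ! l) $ i * A $ (w ! k) $ j * T (w[l := i, k := j]))" .
  qed
  finally have "diff A B = diff B A" .
  then have "(tensor_action A (tensor_action B T) - tensor_action B (tensor_action A T)) w
      = same A B - same B A"
    by (simp only: fun_diff_def comp) simp
  also have "\<dots> = tensor_action (lie_bracket A B) T w"
    by (simp add: same_def tensor_action_def lie_bracket_def left_diff_distrib sum_subtractf)
  finally show "(tensor_action A (tensor_action B T) - tensor_action B (tensor_action A T)) w
      = tensor_action (lie_bracket A B) T w" .
qed

section \<open>Monomials as sorted words\<close>

definition content :: "nat list \<Rightarrow> exponent" where
  "content w = (\<Sum>i\<leftarrow>w. Poly_Mapping.single i 1)"

definition sorted_word :: "nat \<Rightarrow> exponent \<Rightarrow> nat list" where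
  "sorted_word N p = concat (map (\<lambda>i. replicate (Poly_Mapping.lookup p i) i) [0..<N])"

lemma content_simps [simp]:
  "content [] = 0"
  "content (i # w) = Poly_Mapping.single i 1 + content w"
  "content (u @ w) = content u + content w"
  by (simp_all add: content_def)

lemma lookup_content: "Poly_Mapping.lookup (content w) i = count (mset w) i"
  by (induction w) (auto simp: lookup_add lookup_single when_def)

lemma content_cong: "mset u = mset w \<Longrightarrow> content u = content w"
  by (rule poly_mapping_eqI) (simp add: lookup_content)

lemma content_in_exponents: "set w \<subseteq> {..<N} \<Longrightarrow> content w \<in> exponents N"
  by (auto simp: exponents_def in_keys_iff lookup_content)

lemma exponents_add: "p \<in> exponents N \<Longrightarrow> q \<in> exponents N \<Longrightarrow> p + q \<in> exponents N"
  unfolding exponents_def using Poly_Mapping.keys_add[of p q] by blast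

lemma zero_in_exponents: "0 \<in> exponents N"
  by (simp add: exponents_def)

lemma single_in_exponents: "i < N \<Longrightarrow> Poly_Mapping.single i c \<in> exponents N"
  by (auto simp: exponents_def)

lemma total_degree_eq_sum: "p \<in> exponents N \<Longrightarrow> total_degree p = (\<Sum>i<N. Poly_Mapping.lookup p i)"
  unfolding total_degree_def exponents_def
  by (intro sum.mono_neutral_left) (auto simp: in_keys_iff)

lemma total_degree_add:
  "p \<in> exponents N \<Longrightarrow> q \<in> exponents N \<Longrightarrow> total_degree (p + q) = total_degree p + total_degree q"
  by (simp add: total_degree_eq_sum[of _ N] exponents_add lookup_add sum.distrib)

lemma total_degree_content: "set w \<subseteq> {..<N} \<Longrightarrow> total_degree (content w) = length w"
proof (induction w)
  case (Cons i w)
  then have "total_degree (content (i # w)) = total_degree (Poly_Mapping.single i 1) + length w"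
    by (simp add: total_degree_add[of _ N] single_in_exponents content_in_exponents)
  then show ?case by (simp add: total_degree_def)
qed (simp add: total_degree_def)

lemma set_sorted_word: "set (sorted_word N p) \<subseteq> {..<N}"
  by (auto simp: sorted_word_def)

lemma sorted_sorted_word: "sorted (sorted_word N p)"
proof (induction N)
  case (Suc N)
  have "sorted_word (Suc N) p = sorted_word N p @ replicate (Poly_Mapping.lookup p N) N"
    by (simp add: sorted_word_def)
  then show ?case using Suc set_sorted_word[of N p] by (auto simp: sorted_append)
qed (simp add: sorted_word_def)

lemma count_sorted_word:
  "count (mset (sorted_word N p)) i = (if i < N then Poly_Mapping.lookup p i else 0)"
  by (induction N) (auto simp: sorted_word_def)

lemma content_sorted_word: "p \<in> exponents N \<Longrightarrow> content (sorted_word N p) = p"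
  by (rule poly_mapping_eqI) (auto simp: lookup_content count_sorted_word exponents_def in_keys_iff)

lemma sorted_word_content:
  assumes "sorted w" "set w \<subseteq> {..<N}"
  shows "sorted_word N (content w) = w"
proof -
  have "mset (sorted_word N (content w)) = mset w"
  proof (rule multiset_eqI)
    fix i show "count (mset (sorted_word N (content w))) i = count (mset w) i"
      using assms(2) by (auto simp: count_sorted_word lookup_content not_in_iff[symmetric])
  qed
  then have "sort (sorted_word N (content w)) = sort w" by (metis sorted_list_of_multiset_mset)
  then show ?thesis using assms(1) sorted_sorted_word by (simp add: sorted_sort_id)
qed

lemma length_sorted_word: "p \<in> exponents N \<Longrightarrow> length (sorted_word N p) = total_degree p"
  by (metis content_sorted_word set_sorted_word total_degree_content)

lemma monomial_eq_word: "monomial N T p v = foldr T (sorted_word N p) v"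
proof -
  have "foldr T (replicate k i) x = (T i ^^ k) x" for k i and x :: 'a
    by (induction k) auto
  then have "foldr T (concat (map (\<lambda>i. replicate (Poly_Mapping.lookup p i) i) is)) x
      = foldr (\<lambda>i. T i ^^ Poly_Mapping.lookup p i) is x" for "is" x
    by (induction "is") auto
  then show ?thesis by (simp add: monomial_def sorted_word_def)
qed

lemma monomial_content: "sorted w \<Longrightarrow> set w \<subseteq> {..<N} \<Longrightarrow> monomial N T (content w) v = foldr T w v"
  by (simp add: monomial_eq_word sorted_word_content)

lemma finite_exponents_degree: "finite {q \<in> exponents N. total_degree q \<le> s}"
proof (rule finite_subset)
  show "{q \<in> exponents N. total_degree q \<le> s}
      \<subseteq> content ` {w. set w \<subseteq> {..<N} \<and> length w \<le> s}"
  proof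
    fix q assume "q \<in> {q \<in> exponents N. total_degree q \<le> s}"
    then show "q \<in> content ` {w. set w \<subseteq> {..<N} \<and> length w \<le> s}"
      using length_sorted_word[of q N] set_sorted_word[of N q]
      by (intro image_eqI[of _ _ "sorted_word N q"]) (simp_all add: content_sorted_word)
  qed
  show "finite (content ` {w. set w \<subseteq> {..<N} \<and> length w \<le> s})"
    by (intro finite_imageI finite_lists_length_le) simp
qed

section \<open>Homogeneous monomial orders\<close>

locale monomial_order =
  fixes N :: nat and lt :: "exponent \<Rightarrow> exponent \<Rightarrow> bool"
  assumes order: "homogeneous_monomial_order N lt"
begin

lemma lt_irrefl: "p \<in> exponents N \<Longrightarrow> \<not> lt p p"
  using order by (auto simp: homogeneous_monomial_order_def irreflp_on_def)

lemma lt_trans: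
  "p \<in> exponents N \<Longrightarrow> q \<in> exponents N \<Longrightarrow> r \<in> exponents N \<Longrightarrow> lt p q \<Longrightarrow> lt q r \<Longrightarrow> lt p r"
  using order by (auto simp: homogeneous_monomial_order_def dest: transp_onD)

lemma lt_total: "p \<in> exponents N \<Longrightarrow> q \<in> exponents N \<Longrightarrow> p = q \<or> lt p q \<or> lt q p"
  using order by (auto simp: homogeneous_monomial_order_def dest: totalp_onD)

lemma lt_add:
  "p \<in> exponents N \<Longrightarrow> q \<in> exponents N \<Longrightarrow> r \<in> exponents N \<Longrightarrow> lt p q \<Longrightarrow> lt (p + r) (q + r)"
  using order by (auto simp: homogeneous_monomial_order_def)

lemma lt_degree:
  "p \<in> exponents N \<Longrightarrow> q \<in> exponents N \<Longrightarrow> total_degree p < total_degree q \<Longrightarrow> lt p q"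
  using order by (auto simp: homogeneous_monomial_order_def)

lemma lt_degree_le:
  "p \<in> exponents N \<Longrightarrow> q \<in> exponents N \<Longrightarrow> lt p q \<Longrightarrow> total_degree p \<le> total_degree q"
  by (meson lt_degree lt_irrefl lt_trans not_le)

lemma not_lt_zero: "p \<in> exponents N \<Longrightarrow> \<not> lt p 0"
proof
  assume p: "p \<in> exponents N" and "lt p 0"
  then have "total_degree p \<le> total_degree 0" by (intro lt_degree_le zero_in_exponents)
  then have "sorted_word N p = []" using length_sorted_word[OF p] by (simp add: total_degree_def)
  then have "p = 0" using content_sorted_word[OF p] by simp
  then show False using \<open>lt p 0\<close> lt_irrefl p by blast
qed

lemma add_le_add_eq:
  assumes exps: "a \<in> exponents N" "b \<in> exponents N" "p \<in> exponents N" "q \<in> exponents N"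
    and ge: "\<not> lt a p" "\<not> lt b q" and sum: "a + b = p + q \<or> lt (a + b) (p + q)"
  shows "a = p" "b = q"
proof -
  have strict: "lt (p + q) (a + b)" if "\<not> (a = p \<and> b = q)"
  proof -
    have "p = a \<or> lt p a" "q = b \<or> lt q b" using lt_total exps ge by blast+
    moreover have "lt (p + q) (a + q)" if "lt p a" using that lt_add exps by blast
    moreover have "lt (a + q) (a + b)" if "lt q b"
      using lt_add[OF exps(4,2,1) that] by (simp add: add.commute)
    moreover have "p + q \<in> exponents N" "a + q \<in> exponents N" "a + b \<in> exponents N"
      using exps by (auto intro: exponents_add)
    ultimately show ?thesis using that lt_trans by metis
  qed
  have "p + q \<in> exponents N" "a + b \<in> exponents N" using exps by (auto intro: exponents_add)
  then have "a = p \<and> b = q" using strict sum lt_irrefl lt_trans by metis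
  then show "a = p" "b = q" by blast+
qed

text \<open>The order is well-founded, since only finitely many exponents have bounded degree.\<close>

lemma lt_induct [consumes 1, case_names less]:
  assumes "p \<in> exponents N"
    and "\<And>p. p \<in> exponents N \<Longrightarrow> (\<And>q. q \<in> exponents N \<Longrightarrow> lt q p \<Longrightarrow> P q) \<Longrightarrow> P p"
  shows "P p"
  using assms(1)
proof (induction "card {q \<in> exponents N. lt q p}" arbitrary: p rule: less_induct)
  case less
  have "P q" if q: "q \<in> exponents N" "lt q p" for q
  proof (rule less.hyps[OF _ q(1)], rule psubset_card_mono)
    show "finite {q \<in> exponents N. lt q p}"
      using lt_degree_le less.prems
      by (auto intro!: finite_subset[OF _ finite_exponents_degree[of N "total_degree p"]])
    show "{r \<in> exponents N. lt r q} \<subset> {q \<in> exponents N. lt q p}"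
      using q less.prems lt_trans lt_irrefl by blast
  qed
  then show ?case using assms(2) less.prems by blast
qed

lemma greatest_exponent:
  assumes "finite K" "K \<noteq> {}" "K \<subseteq> exponents N"
  obtains m where "m \<in> K" "\<And>q. q \<in> K \<Longrightarrow> q \<noteq> m \<Longrightarrow> lt q m"
proof -
  have "\<exists>m\<in>K. \<forall>q\<in>K. q \<noteq> m \<longrightarrow> lt q m"
    using assms
  proof (induction rule: finite_ne_induct)
    case (insert x F)
    then obtain m where m: "m \<in> F" "\<forall>q\<in>F. q \<noteq> m \<longrightarrow> lt q m" by blast
    with insert show ?case using lt_total[of x m] lt_trans[of _ m x] by (metis insert_iff insert_subset subsetD)
  qed simp
  then show ?thesis using that by blast
qed

end

section \<open>Essential exponents of a tensor product\<close>

text \<open>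
  The terms of the coproduct of \<open>U(\<gg>)\<close> on a product of Lie algebra elements.  They form a list
  because repeated terms have to be counted; subwords of sorted words are sorted, so splitting a
  monomial gives monomials.
\<close>

fun splittings :: "'a list \<Rightarrow> ('a list \<times> 'a list) list" where
  "splittings [] = [([], [])]"
| "splittings (i # w) = map (\<lambda>(u, u'). (i # u, u')) (splittings w) @ map (\<lambda>(u, u'). (u, i # u')) (splittings w)"

lemma splittings_mset: "(u, u') \<in> set (splittings w) \<Longrightarrow> mset u + mset u' = mset w"
  by (induction w arbitrary: u u') auto

lemma splittings_set: "(u, u') \<in> set (splittings w) \<Longrightarrow> set u \<subseteq> set w \<and> set u' \<subseteq> set w"
  by (induction w arbitrary: u u') fastforce+

lemma splittings_sorted: "(u, u') \<in> set (splittings w) \<Longrightarrow> sorted w \<Longrightarrow> sorted u \<and> sorted u'"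
proof (induction w arbitrary: u u')
  case (Cons i w)
  then show ?case using splittings_set[of _ _ w] by fastforce
qed simp

lemma splittings_complete:
  "sorted u \<Longrightarrow> sorted u' \<Longrightarrow> sorted w \<Longrightarrow> mset u + mset u' = mset w \<Longrightarrow> (u, u') \<in> set (splittings w)"
proof (induction w arbitrary: u u')
  case (Cons i w)
  have le: "i \<le> j" if "j \<in># mset u + mset u'" for j
    using that Cons.prems by auto
  have "i \<in># mset u + mset u'" using Cons.prems(4) by simp
  then consider "i \<in> set u" | "i \<in> set u'" by auto
  then show ?case
  proof cases
    case 1
    then obtain k u1 where u: "u = k # u1" by (cases u) auto
    with 1 le Cons.prems(1) have "k = i" by (auto intro: antisym)
    then show ?thesis using u Cons by force
  next
    case 2
    then obtain k u1 where u: "u' = k # u1" by (cases u') auto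
    with 2 le Cons.prems(2) have "k = i" by (auto intro: antisym)
    then show ?thesis using u Cons by force
  qed
qed simp

definition tensor_cons :: "complex^'d \<Rightarrow> 'd tensor \<Rightarrow> 'd tensor" where
  "tensor_cons x S = (\<lambda>w. case w of [] \<Rightarrow> 0 | i # w' \<Rightarrow> x $ i * S w')"

lemma tensor_power_vector_0: "tensor_power_vector 0 v = (\<lambda>w. if w = [] then 1 else 0)"
  by (auto simp: tensor_power_vector_def pure_tensor_def)

lemma tensor_power_vector_Suc: "tensor_power_vector (Suc n) v = tensor_cons v (tensor_power_vector n v)"
  by (auto simp: tensor_power_vector_def pure_tensor_def tensor_cons_def fun_eq_iff
      prod.lessThan_Suc_shift simp del: prod.lessThan_Suc split: list.split)

lemma tensor_action_cons:
  "tensor_action A (tensor_cons x S) = tensor_cons (A *v x) S + tensor_cons x (tensor_action A S)"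
proof
  fix w :: "'a list"
  show "tensor_action A (tensor_cons x S) w = (tensor_cons (A *v x) S + tensor_cons x (tensor_action A S)) w"
  proof (cases w)
    case (Cons i w')
    then show ?thesis
      by (simp add: tensor_action_def tensor_cons_def lessThan_Suc_eq_insert_0 sum.reindex
          matrix_vector_mult_def sum_distrib_right sum_distrib_left mult_ac)
  qed (simp add: tensor_action_def tensor_cons_def)
qed

lemma tensor_action_sum_list:
  "tensor_action A (\<Sum>x\<leftarrow>xs. F x) = (\<Sum>x\<leftarrow>xs. tensor_action A (F x))"
proof (induction xs)
  case Nil
  show ?case by (simp add: tensor_action_def fun_eq_iff)
next
  case (Cons x xs)
  then show ?case by (simp only: list.map sum_list.Cons tensor_action_add)
qed

lemma word_action_tensor_cons:
  "foldr (\<lambda>i. tensor_action (A i)) w (tensor_cons x S)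
    = (\<Sum>(u, u')\<leftarrow>splittings w. tensor_cons (foldr (\<lambda>i y. A i *v y) u x) (foldr (\<lambda>i. tensor_action (A i)) u' S))"
  by (induction w)
    (simp_all add: tensor_action_sum_list tensor_action_cons sum_list_addf o_def case_prod_unfold)

lemma vector_space_complex_mult: "vector_space ((*) :: complex \<Rightarrow> complex \<Rightarrow> complex)"
  by unfold_locales (simp_all add: algebra_simps)

lemma separating_functional:
  fixes scl :: "complex \<Rightarrow> 'v::ab_group_add \<Rightarrow> 'v"
  assumes "vector_space scl" and x: "x \<notin> Modules.module.span scl S"
  obtains \<phi> where "Vector_Spaces.linear scl (*) \<phi>" "\<phi> x = 1"
    "\<And>y. y \<in> Modules.module.span scl S \<Longrightarrow> \<phi> y = 0"
proof -
  interpret vector_space scl by fact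
  interpret vector_space_pair scl "(*) :: complex \<Rightarrow> complex \<Rightarrow> complex"
    using assms(1) vector_space_complex_mult by (simp add: vector_space_pair_def)
  obtain B where B: "B \<subseteq> S" "independent B" "S \<subseteq> span B"
    using maximal_independent_subset[of S] by blast
  have SB: "span B = span S" using B by (metis span_mono span_span subset_antisym)
  have ind: "independent (insert x B)" using B(2) x SB by (intro independent_insertI) auto
  obtain \<phi> where \<phi>: "Vector_Spaces.linear scl (*) \<phi>"
    "\<forall>y\<in>insert x B. \<phi> y = (if y = x then 1 else 0)"
    using linear_independent_extend[OF ind, of "\<lambda>y. if y = x then 1 else 0"] by blast
  interpret \<phi>: Vector_Spaces.linear scl "(*)" \<phi> by fact
  have "x \<notin> B" using x SB span_base by blast
  then have "\<forall>y\<in>B. \<phi> y = 0" using \<phi>(2) by auto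
  then have "\<phi> y = 0" if "y \<in> span B" for y
    using \<phi>.eq_0_on_span[of B y] that by blast
  then show ?thesis using that \<phi> SB by auto
qed

text \<open>The functional \<open>\<phi> \<otimes> \<Phi>\<close>.\<close>

definition functional_cons :: "(complex^'d \<Rightarrow> complex) \<Rightarrow> ('d tensor \<Rightarrow> complex) \<Rightarrow> 'd tensor \<Rightarrow> complex" where
  "functional_cons \<phi> \<Phi> S = \<phi> (\<chi> i. \<Phi> (\<lambda>w. S (i # w)))"

lemma functional_cons_linear:
  assumes "Vector_Spaces.linear (*s) (*) \<phi>" "Vector_Spaces.linear tensor_scale (*) \<Phi>"
  shows "Vector_Spaces.linear tensor_scale (*) (functional_cons \<phi> \<Phi>)"
proof -
  interpret \<phi>: Vector_Spaces.linear "(*s)" "(*)" \<phi> by fact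
  interpret \<Phi>: Vector_Spaces.linear tensor_scale "(*)" \<Phi> by fact
  have add: "\<Phi> (\<lambda>w. f w + g w) = \<Phi> f + \<Phi> g" for f g
    using \<Phi>.add[of f g] by (simp add: plus_fun_def)
  have scl: "\<Phi> (\<lambda>w. c * f w) = c * \<Phi> f" for c f
    using \<Phi>.scale[of c f] by (simp add: tensor_scale_def)
  show ?thesis
  proof (unfold_locales, goal_cases)
    case (1 S S')
    have "(\<chi> i. \<Phi> (\<lambda>w. S (i # w)) + \<Phi> (\<lambda>w. S' (i # w)))
      = (\<chi> i. \<Phi> (\<lambda>w. S (i # w))) + (\<chi> i. \<Phi> (\<lambda>w. S' (i # w)))"
      by (simp add: vec_eq_iff)
    then show ?case by (simp add: functional_cons_def add \<phi>.add)
  next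
    case (2 c S)
    have "(\<chi> i. c * \<Phi> (\<lambda>w. S (i # w))) = c *s (\<chi> i. \<Phi> (\<lambda>w. S (i # w)))"
      by (simp add: vec_eq_iff)
    then show ?case by (simp add: functional_cons_def tensor_scale_def scl \<phi>.scale)
  qed
qed

lemma functional_cons_tensor_cons:
  assumes "Vector_Spaces.linear (*s) (*) \<phi>" "Vector_Spaces.linear tensor_scale (*) \<Phi>"
  shows "functional_cons \<phi> \<Phi> (tensor_cons x S) = \<phi> x * \<Phi> S"
proof -
  interpret \<phi>: Vector_Spaces.linear "(*s)" "(*)" \<phi> by fact
  interpret \<Phi>: Vector_Spaces.linear tensor_scale "(*)" \<Phi> by fact
  have "(\<chi> i. \<Phi> (\<lambda>w. x $ i * S w)) = \<Phi> S *s x"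
    using \<Phi>.scale by (simp add: vec_eq_iff tensor_scale_def)
  then show ?thesis by (simp add: functional_cons_def tensor_cons_def \<phi>.scale)
qed

lemma linear_sum_list:
  assumes "Vector_Spaces.linear s1 s2 \<Phi>"
  shows "\<Phi> (\<Sum>x\<leftarrow>xs. F x) = (\<Sum>x\<leftarrow>xs. \<Phi> (F x))"
proof -
  interpret Vector_Spaces.linear s1 s2 \<Phi> by fact
  show ?thesis by (induction xs) (simp_all only: list.map sum_list.Cons sum_list.Nil zero add)
qed

lemma minkowski_multiple_Suc: "minkowski_multiple (Suc n) S = S + minkowski_multiple n S"
  by (simp add: minkowski_multiple_def)

lemma monomial_zero: "monomial N T 0 v = v"
  using monomial_content[of "[]" N T v] by simp

context monomial_order
begin

definition dual_functional where
  "dual_functional scl T v p \<Phi> \<longleftrightarrow>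
     Vector_Spaces.linear scl (*) \<Phi> \<and> \<Phi> (monomial N T p v) \<noteq> (0 :: complex) \<and>
     (\<forall>q\<in>exponents N. lt q p \<longrightarrow> \<Phi> (monomial N T q v) = 0)"

lemma essential_iff_dual_functional:
  fixes scl :: "complex \<Rightarrow> 'v::ab_group_add \<Rightarrow> 'v"
  assumes "vector_space scl" and p: "p \<in> exponents N"
  shows "p \<in> essential_exponents scl N lt T v \<longleftrightarrow> (\<exists>\<Phi>. dual_functional scl T v p \<Phi>)"
proof -
  interpret vector_space scl by fact
  show ?thesis
  proof
    assume "p \<in> essential_exponents scl N lt T v"
    then have "monomial N T p v \<notin> span {monomial N T q v |q. q \<in> exponents N \<and> lt q p}"
      by (simp add: essential_exponents_def filtration_less_def)
    from separating_functional[OF assms(1) this]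
    obtain \<phi> where "Vector_Spaces.linear scl (*) \<phi>" "\<phi> (monomial N T p v) = 1"
      "\<And>y. y \<in> span {monomial N T q v |q. q \<in> exponents N \<and> lt q p} \<Longrightarrow> \<phi> y = 0"
      by blast
    then have "dual_functional scl T v p \<phi>"
      by (auto simp: dual_functional_def intro!: span_base)
    then show "\<exists>\<Phi>. dual_functional scl T v p \<Phi>" by blast
  next
    assume "\<exists>\<Phi>. dual_functional scl T v p \<Phi>"
    then obtain \<Phi> where \<Phi>: "dual_functional scl T v p \<Phi>" ..
    interpret \<Phi>: Vector_Spaces.linear scl "(*)" \<Phi> using \<Phi> by (simp add: dual_functional_def)
    have "\<Phi> y = 0" if "y \<in> filtration_less scl N lt T v p" for y
      using \<Phi>.eq_0_on_span[of "{monomial N T q v |q. q \<in> exponents N \<and> lt q p}" y] \<Phi> that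
      by (auto simp: dual_functional_def filtration_less_def)
    then show "p \<in> essential_exponents scl N lt T v"
      using p \<Phi> by (auto simp: essential_exponents_def dual_functional_def)
  qed
qed

text \<open>
  Applying \<open>\<phi> \<otimes> \<Phi>\<close> to the coproduct of a monomial \<open>q \<le> p + p'\<close> leaves only the splittings into
  \<open>p\<close> and \<open>p'\<close>: any other splitting of \<open>q\<close> has a factor that is smaller than \<open>p\<close> or \<open>p'\<close>.
\<close>

lemma dual_functional_tensor_cons:
  fixes A :: "nat \<Rightarrow> complex^'d^'d"
  assumes exps: "p \<in> exponents N" "p' \<in> exponents N"
    and \<phi>: "dual_functional (*s) (\<lambda>i x. A i *v x) x p \<phi>"
    and \<Phi>: "dual_functional tensor_scale (\<lambda>i. tensor_action (A i)) S p' \<Phi>"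
  shows "dual_functional tensor_scale (\<lambda>i. tensor_action (A i)) (tensor_cons x S) (p + p')
    (functional_cons \<phi> \<Phi>)"
proof -
  let ?T = "\<lambda>i x. A i *v x" and ?T' = "\<lambda>i. tensor_action (A i)"
  let ?\<gamma> = "\<phi> (monomial N ?T p x) * \<Phi> (monomial N ?T' p' S)"
  let ?split = "\<lambda>(u, u'). u = sorted_word N p \<and> u' = sorted_word N p'"
  have lin: "Vector_Spaces.linear (*s) (*) \<phi>" "Vector_Spaces.linear tensor_scale (*) \<Phi>"
    using \<phi> \<Phi> by (simp_all add: dual_functional_def)
  note lin' = functional_cons_linear[OF lin]
  have val: "functional_cons \<phi> \<Phi> (monomial N ?T' q (tensor_cons x S))
      = of_nat (length (filter ?split (splittings (sorted_word N q)))) * ?\<gamma>"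
    if q: "q \<in> exponents N" "q = p + p' \<or> lt q (p + p')" for q
  proof -
    let ?w = "sorted_word N q"
    have term_eq: "\<phi> (foldr ?T u x) * \<Phi> (foldr ?T' u' S) = (if ?split (u, u') then ?\<gamma> else 0)"
      if uu': "(u, u') \<in> set (splittings ?w)" for u u'
    proof (cases "?split (u, u')")
      case True
      then show ?thesis by (simp add: monomial_eq_word)
    next
      case False
      have sorted: "sorted u" "sorted u'" and sets: "set u \<subseteq> {..<N}" "set u' \<subseteq> {..<N}"
        using splittings_sorted[OF uu' sorted_sorted_word] splittings_set[OF uu'] set_sorted_word[of N q]
        by auto
      have "content u + content u' = content ?w"
        using content_cong[of "u @ u'" ?w] splittings_mset[OF uu'] by simp
      then have sum: "content u + content u' = q" by (simp add: content_sorted_word q(1))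
      have "content u \<noteq> p \<or> content u' \<noteq> p'"
        using False sorted sets sorted_word_content by fastforce
      moreover note exps' = content_in_exponents[OF sets(1)] content_in_exponents[OF sets(2)]
      ultimately have "lt (content u) p \<or> lt (content u') p'"
        using add_le_add_eq[OF exps' exps] q(2) sum by blast
      then have "\<phi> (foldr ?T u x) = 0 \<or> \<Phi> (foldr ?T' u' S) = 0"
        using \<phi> \<Phi> exps' sorted sets
        by (metis dual_functional_def monomial_content)
      then show ?thesis using False by auto
    qed
    have "functional_cons \<phi> \<Phi> (monomial N ?T' q (tensor_cons x S))
        = (\<Sum>(u, u')\<leftarrow>splittings ?w. \<phi> (foldr ?T u x) * \<Phi> (foldr ?T' u' S))"
      by (simp add: monomial_eq_word word_action_tensor_cons linear_sum_list[OF lin']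
          functional_cons_tensor_cons[OF lin] case_prod_unfold)
    also have "\<dots> = (\<Sum>s\<leftarrow>splittings ?w. if ?split s then ?\<gamma> else 0)"
      using term_eq by (intro arg_cong[of _ _ sum_list] map_cong refl) (auto simp: case_prod_unfold)
    also have "\<dots> = of_nat (length (filter ?split (splittings ?w))) * ?\<gamma>"
      by (simp add: sum_list_map_filter'[symmetric] sum_list_triv)
    finally show ?thesis .
  qed
  have exp: "p + p' \<in> exponents N" using exps by (rule exponents_add)
  show ?thesis
    unfolding dual_functional_def
  proof (intro conjI ballI impI)
    let ?w = "sorted_word N (p + p')"
    have "mset (sorted_word N p) + mset (sorted_word N p') = mset ?w"
      by (intro multiset_eqI) (simp add: count_sorted_word lookup_add)
    then have "(sorted_word N p, sorted_word N p') \<in> set (splittings ?w)"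
      by (intro splittings_complete sorted_sorted_word)
    then have "filter ?split (splittings ?w) \<noteq> []" by (force simp: filter_empty_conv)
    then show "functional_cons \<phi> \<Phi> (monomial N ?T' (p + p') (tensor_cons x S)) \<noteq> 0"
      using \<phi> \<Phi> val[OF exp] by (simp add: dual_functional_def)
  next
    fix q assume q: "q \<in> exponents N" "lt q (p + p')"
    have "\<not> ?split s" if "s \<in> set (splittings (sorted_word N q))" for s
    proof
      assume "?split s"
      then have "mset (sorted_word N p @ sorted_word N p') = mset (sorted_word N q)"
        using splittings_mset[of "fst s" "snd s"] that by auto
      then have "p + p' = q"
        using content_cong exps q(1) by (fastforce simp: content_sorted_word)
      then show False using q lt_irrefl by blast
    qed
    then have "filter ?split (splittings (sorted_word N q)) = []" by (simp only: filter_empty_conv) blast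
    then show "functional_cons \<phi> \<Phi> (monomial N ?T' q (tensor_cons x S)) = 0"
      using val[of q] q by simp
  qed (rule lin')
qed

lemma minkowski_multiple_dual_functional:
  fixes A :: "nat \<Rightarrow> complex^'d^'d"
  assumes "p \<in> minkowski_multiple n (essential_exponents (*s) N lt (\<lambda>i x. A i *v x) v)"
  shows "p \<in> exponents N \<and>
    (\<exists>\<Phi>. dual_functional tensor_scale (\<lambda>i. tensor_action (A i)) (tensor_power_vector n v) p \<Phi>)"
  using assms
proof (induction n arbitrary: p)
  case 0
  interpret vector_space_pair tensor_scale "(*) :: complex \<Rightarrow> complex \<Rightarrow> complex"
    by (simp add: vector_space_pair_def vector_space_tensor_scale vector_space_complex_mult)
  have p: "p = 0" using 0 by (simp add: minkowski_multiple_def)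
  have "Vector_Spaces.linear tensor_scale (*) (\<lambda>S :: 'd tensor. S [])"
    by unfold_locales (simp_all add: tensor_scale_def)
  then have "dual_functional tensor_scale (\<lambda>i. tensor_action (A i)) (tensor_power_vector 0 v) 0 (\<lambda>S. S [])"
    using not_lt_zero
    by (auto simp: dual_functional_def monomial_zero tensor_power_vector_0)
  then show ?case using p zero_in_exponents by blast
next
  case (Suc n)
  then obtain p1 p2 where p: "p = p1 + p2" "p1 \<in> essential_exponents (*s) N lt (\<lambda>i x. A i *v x) v"
    "p2 \<in> minkowski_multiple n (essential_exponents (*s) N lt (\<lambda>i x. A i *v x) v)"
    by (auto simp: minkowski_multiple_Suc elim: set_plus_elim)
  have p1: "p1 \<in> exponents N" using p(2) by (simp add: essential_exponents_def)
  obtain \<phi> where \<phi>: "dual_functional (*s) (\<lambda>i x. A i *v x) v p1 \<phi>"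
    using p(2) essential_iff_dual_functional[OF vec.vector_space_axioms p1] by blast
  then show ?case
    using Suc.IH[OF p(3)] p(1) p1 dual_functional_tensor_cons[OF p1 _ \<phi>]
    by (auto simp: tensor_power_vector_Suc exponents_add)
qed

corollary minkowski_multiple_essential:
  fixes A :: "nat \<Rightarrow> complex^'d^'d"
  shows "minkowski_multiple n (essential_exponents (*s) N lt (\<lambda>i x. A i *v x) v)
    \<subseteq> essential_exponents tensor_scale N lt (\<lambda>i. tensor_action (A i)) (tensor_power_vector n v)"
  using minkowski_multiple_dual_functional essential_iff_dual_functional[OF vector_space_tensor_scale]
  by blast

end

section \<open>Bases of essential monomials\<close>

locale complex_vector_space = vector_space scl
  for scl :: "complex \<Rightarrow> 'v::ab_group_add \<Rightarrow> 'v"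
begin

lemma span_image_finite:
  assumes "finite K"
  shows "span (b ` K) = range (\<lambda>c. \<Sum>j\<in>K. scl (c j) (b j))"
proof
  show "range (\<lambda>c. \<Sum>j\<in>K. scl (c j) (b j)) \<subseteq> span (b ` K)"
    by (clarify, intro span_sum span_scale span_base imageI)
  have "subspace (range (\<lambda>c. \<Sum>j\<in>K. scl (c j) (b j)))"
  proof (rule subspaceI)
    show "0 \<in> range (\<lambda>c. \<Sum>j\<in>K. scl (c j) (b j))"
      by (rule range_eqI[of _ _ "\<lambda>_. 0"]) simp
    fix x y assume "x \<in> range (\<lambda>c. \<Sum>j\<in>K. scl (c j) (b j))" "y \<in> range (\<lambda>c. \<Sum>j\<in>K. scl (c j) (b j))"
    then obtain c c' where "x = (\<Sum>j\<in>K. scl (c j) (b j))" "y = (\<Sum>j\<in>K. scl (c' j) (b j))" by blast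
    then show "x + y \<in> range (\<lambda>c. \<Sum>j\<in>K. scl (c j) (b j))"
      by (intro range_eqI[of _ _ "\<lambda>j. c j + c' j"]) (simp add: scale_left_distrib sum.distrib)
  next
    fix a x assume "x \<in> range (\<lambda>c. \<Sum>j\<in>K. scl (c j) (b j))"
    then obtain c where "x = (\<Sum>j\<in>K. scl (c j) (b j))" by blast
    then show "scl a x \<in> range (\<lambda>c. \<Sum>j\<in>K. scl (c j) (b j))"
      by (intro range_eqI[of _ _ "\<lambda>j. a * c j"]) (simp add: scale_sum_right)
  qed
  moreover have "b ` K \<subseteq> range (\<lambda>c. \<Sum>j\<in>K. scl (c j) (b j))"
  proof clarify
    fix k assume "k \<in> K"
    then have "b k = (\<Sum>j\<in>K. scl (if j = k then 1 else 0) (b j))"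
      using assms by (simp add: if_distrib[of "\<lambda>c. scl c _"] cong: if_cong)
    then show "b k \<in> range (\<lambda>c. \<Sum>j\<in>K. scl (c j) (b j))"
      by (rule range_eqI[of _ _ "\<lambda>j. if j = k then 1 else 0"])
  qed
  ultimately show "span (b ` K) \<subseteq> range (\<lambda>c. \<Sum>j\<in>K. scl (c j) (b j))"
    by (rule span_minimal[rotated])
qed

text \<open>In contrast to independence of the set \<open>b ` J\<close>, this includes that \<open>b\<close> is injective on \<open>J\<close>.\<close>

definition independent_family :: "('i \<Rightarrow> 'v) \<Rightarrow> 'i set \<Rightarrow> bool" where
  "independent_family b J \<longleftrightarrow>
     (\<forall>K c. finite K \<and> K \<subseteq> J \<and> (\<Sum>j\<in>K. scl (c j) (b j)) = 0 \<longrightarrow> (\<forall>j\<in>K. c j = 0))"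

lemma independent_familyD:
  "independent_family b J \<Longrightarrow> finite K \<Longrightarrow> K \<subseteq> J \<Longrightarrow> (\<Sum>j\<in>K. scl (c j) (b j)) = 0 \<Longrightarrow> j \<in> K \<Longrightarrow> c j = 0"
  unfolding independent_family_def by blast

lemma independent_family_mono: "independent_family b J \<Longrightarrow> K \<subseteq> J \<Longrightarrow> independent_family b K"
  unfolding independent_family_def by blast

lemma independent_family_inj:
  assumes "independent_family b J"
  shows "inj_on b J"
proof (rule inj_onI, rule ccontr)
  fix p q assume pq: "p \<in> J" "q \<in> J" "b p = b q" "p \<noteq> q"
  then have "(\<Sum>j\<in>{p, q}. scl (if j = p then 1 else -1) (b j)) = 0" by simp
  then show False
    using independent_familyD[OF assms, of "{p, q}" "\<lambda>j. if j = p then 1 else -1" p] pq by simp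
qed

lemma independent_family_independent:
  assumes "independent_family b J"
  shows "independent (b ` J)"
proof
  assume "dependent (b ` J)"
  then obtain t u where t: "finite t" "t \<subseteq> b ` J" "(\<Sum>x\<in>t. scl (u x) x) = 0" "\<exists>x\<in>t. u x \<noteq> 0"
    unfolding dependent_explicit by blast
  obtain K where K: "K \<subseteq> J" "finite K" "t = b ` K" using finite_subset_image[OF t(1,2)] by blast
  have "inj_on b K" using independent_family_inj[OF assms] K inj_on_subset by blast
  then have "(\<Sum>j\<in>K. scl (u (b j)) (b j)) = 0" using t(3) K(3) by (simp add: sum.reindex)
  then show False using independent_familyD[OF assms K(2,1), of "\<lambda>j. u (b j)"] t(4) K(3) by blast
qed

text \<open>Exchange argument; positivity of the dimension excludes the infinite-dimensional case, for
  which \<open>dim\<close> has the default value 0.\<close>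

lemma card_eq_dim_spans:
  assumes J: "independent_family b J" and S: "b ` J \<subseteq> span S"
    and K: "K \<subseteq> J" "finite K" "K \<noteq> {}" "dim (span S) = card K"
  shows "J = K" "span (b ` K) = span S"
proof -
  obtain B where B: "B \<subseteq> span S" "independent B" "span S \<subseteq> span B" "card B = dim (span S)"
    by (rule basis_exists)
  have SB: "span B = span S" using B(1,3) span_minimal[OF B(1)] by auto
  have "finite B" using B(4) K by (metis card.infinite card_0_eq)
  have card: "card C \<le> card K \<and> finite C" if "independent C" "C \<subseteq> span S" for C
    using independent_span_bound[OF \<open>finite B\<close> that(1)] that(2) B(4) K(4) SB by auto
  have inj: "inj_on b J" by (rule independent_family_inj[OF J])
  have cardK: "card (b ` K) = card K" using inj K(1) by (intro card_image) (rule inj_on_subset)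
  have "card (b ` J) \<le> card K" "finite (b ` J)"
    using card[OF independent_family_independent[OF J] S] by auto
  then have "finite J" "card J \<le> card K" using inj by (auto simp: finite_image_iff card_image)
  then show "J = K" using K(1) by (metis card_seteq)
  show "span (b ` K) = span S"
  proof (rule ccontr)
    assume "span (b ` K) \<noteq> span S"
    moreover have "span (b ` K) \<subseteq> span S" using S K(1) by (intro span_minimal) auto
    ultimately obtain x where x: "x \<in> span S" "x \<notin> span (b ` K)" by blast
    have "independent (insert x (b ` K))"
      using x independent_family_independent[OF independent_family_mono[OF J K(1)]]
      by (intro independent_insertI) auto
    moreover have "insert x (b ` K) \<subseteq> span S" using x S K(1) by auto
    ultimately have "card (insert x (b ` K)) \<le> card K" using card by blast
    moreover have "x \<notin> b ` K" using x span_base by blast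
    ultimately show False using cardK K(2) by simp
  qed
qed

end

locale ordered_monomials = complex_vector_space scl + monomial_order N lt
  for scl :: "complex \<Rightarrow> 'v::ab_group_add \<Rightarrow> 'v" and N lt +
  fixes T :: "nat \<Rightarrow> 'v \<Rightarrow> 'v" and v :: 'v
begin

abbreviation "es \<equiv> essential_exponents scl N lt T v"
abbreviation "b p \<equiv> monomial N T p v"

lemma es_subset: "es \<subseteq> exponents N"
  by (auto simp: essential_exponents_def)

lemma filtration_less_eq_span: "filtration_less scl N lt T v p = span (b ` {q \<in> exponents N. lt q p})"
  unfolding filtration_less_def by (rule arg_cong[of _ _ span]) auto

lemma filtration_le_eq_span:
  "filtration_le scl N lt T v p = span (b ` {q \<in> exponents N. lt q p \<or> q = p})"
  unfolding filtration_le_def by (rule arg_cong[of _ _ span]) auto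

text \<open>In a vanishing combination, the largest exponent with nonzero coefficient would not be
  essential.\<close>

lemma essential_independent: "independent_family b es"
  unfolding independent_family_def
proof (intro allI impI ballI, elim conjE, rule ccontr)
  fix K c j assume K: "finite K" "K \<subseteq> es" "(\<Sum>j\<in>K. scl (c j) (b j)) = 0" and j: "j \<in> K" "c j \<noteq> 0"
  let ?K = "{j \<in> K. c j \<noteq> 0}"
  have "finite ?K" "?K \<noteq> {}" "?K \<subseteq> exponents N" using K j es_subset by auto
  then obtain m where m: "m \<in> ?K" "\<And>q. q \<in> ?K \<Longrightarrow> q \<noteq> m \<Longrightarrow> lt q m" by (rule greatest_exponent) blast
  have "0 = (\<Sum>j\<in>?K. scl (c j) (b j))"
    unfolding K(3)[symmetric] using K(1) by (intro sum.mono_neutral_right) auto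
  also have "\<dots> = scl (c m) (b m) + (\<Sum>j\<in>?K - {m}. scl (c j) (b j))"
    using K(1) m(1) by (intro sum.remove) auto
  finally have "scl (c m) (b m) = - (\<Sum>j\<in>?K - {m}. scl (c j) (b j))"
    by (simp add: eq_neg_iff_add_eq_0)
  moreover have "(\<Sum>j\<in>?K - {m}. scl (c j) (b j)) \<in> filtration_less scl N lt T v m"
    unfolding filtration_less_eq_span
  proof (intro span_sum span_scale span_base imageI)
    fix q assume "q \<in> ?K - {m}"
    then show "q \<in> {q \<in> exponents N. lt q m}" using m(2) K(2) es_subset by blast
  qed
  ultimately have "scl (c m) (b m) \<in> filtration_less scl N lt T v m"
    by (simp add: filtration_less_eq_span span_neg)
  then have "scl (inverse (c m)) (scl (c m) (b m)) \<in> filtration_less scl N lt T v m"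
    unfolding filtration_less_eq_span by (rule span_scale)
  then show False using m(1) K(2) by (auto simp: essential_exponents_def)
qed

text \<open>By induction along the order, an inessential monomial is a combination of smaller essential
  ones.\<close>

lemma span_essential:
  assumes D: "D \<subseteq> exponents N" and down: "\<And>p q. p \<in> D \<Longrightarrow> q \<in> exponents N \<Longrightarrow> lt q p \<Longrightarrow> q \<in> D"
  shows "span (b ` D) = span (b ` (D \<inter> es))"
proof
  have "b p \<in> span (b ` (D \<inter> es))" if "p \<in> exponents N" "p \<in> D" for p
    using that
  proof (induction p rule: lt_induct)
    case (less p)
    show ?case
    proof (cases "p \<in> es")
      case False
      then have "b p \<in> span (b ` {q \<in> exponents N. lt q p})"
        using less.hyps by (simp add: essential_exponents_def filtration_less_eq_span)
      also have "\<dots> \<subseteq> span (b ` (D \<inter> es))"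
        using less.IH less.prems down by (intro span_minimal) auto
      finally show ?thesis .
    qed (use less.prems in \<open>auto intro: span_base\<close>)
  qed
  then show "span (b ` D) \<subseteq> span (b ` (D \<inter> es))" using D by (intro span_minimal) auto
  show "span (b ` (D \<inter> es)) \<subseteq> span (b ` D)" by (intro span_mono) auto
qed

lemma filtration_less_eq_span_essential:
  assumes "p \<in> exponents N"
  shows "filtration_less scl N lt T v p = span (b ` {q \<in> es. lt q p})"
proof -
  have "span (b ` {q \<in> exponents N. lt q p}) = span (b ` ({q \<in> exponents N. lt q p} \<inter> es))"
    by (rule span_essential) (use assms lt_trans in blast)+
  also have "{q \<in> exponents N. lt q p} \<inter> es = {q \<in> es. lt q p}" using es_subset by auto
  finally show ?thesis by (simp add: filtration_less_eq_span)
qed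

lemma filtration_le_eq_span_essential:
  assumes "p \<in> exponents N"
  shows "filtration_le scl N lt T v p = span (b ` {q \<in> es. lt q p \<or> q = p})"
proof -
  have "span (b ` {q \<in> exponents N. lt q p \<or> q = p}) = span (b ` ({q \<in> exponents N. lt q p \<or> q = p} \<inter> es))"
    by (rule span_essential) (use assms lt_trans in blast)+
  also have "{q \<in> exponents N. lt q p \<or> q = p} \<inter> es = {q \<in> es. lt q p \<or> q = p}" using es_subset by auto
  finally show ?thesis by (simp add: filtration_le_eq_span)
qed

end

section \<open>Straightening\<close>

text \<open>
  A representation of the Lie algebra \<open>\<gg>\<close> with basis \<open>f\<close>, reduced to what the straightening of
  products needs.
\<close>

locale lie_module = complex_vector_space scl
  for scl :: "complex \<Rightarrow> 'v::ab_group_add \<Rightarrow> 'v" +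
  fixes \<gg> :: "'g set" and act :: "'g \<Rightarrow> 'v \<Rightarrow> 'v" and f :: "nat \<Rightarrow> 'g" and N :: nat and v :: 'v
  assumes act_linear: "X \<in> \<gg> \<Longrightarrow> Vector_Spaces.linear scl scl (act X)"
    and basis: "i < N \<Longrightarrow> f i \<in> \<gg>"
    and expand: "X \<in> \<gg> \<Longrightarrow> \<exists>c. \<forall>x. act X x = (\<Sum>k<N. scl (c k) (act (f k) x))"
    and bracket: "X \<in> \<gg> \<Longrightarrow> Y \<in> \<gg> \<Longrightarrow> \<exists>Z\<in>\<gg>. \<forall>x. act X (act Y x) - act Y (act X x) = act Z x"
begin

abbreviation "T i \<equiv> act (f i)"
abbreviation "L s \<equiv> degree_filtration scl \<gg> act v s"

lemma act_diff: "X \<in> \<gg> \<Longrightarrow> act X (x - y) = act X x - act X y"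
  using act_linear by (auto simp: Vector_Spaces.linear_def intro: module_hom.diff)

lemma act_span:
  assumes "X \<in> \<gg>" "x \<in> span S" "\<And>y. y \<in> S \<Longrightarrow> act X y \<in> span S'"
  shows "act X x \<in> span S'"
proof -
  interpret act: Vector_Spaces.linear scl scl "act X" using assms(1) by (rule act_linear)
  have "act X x \<in> act X ` span S" using assms(2) by blast
  also have "\<dots> = span (act X ` S)" by (rule act.span_image[symmetric])
  also have "\<dots> \<subseteq> span S'" using assms(3) by (intro span_minimal) auto
  finally show ?thesis .
qed

lemma degree_filtration_mono: "s \<le> t \<Longrightarrow> L s \<subseteq> L t"
  unfolding degree_filtration_def by (intro span_mono) auto

lemma degree_filtration_act:
  assumes "X \<in> \<gg>" "x \<in> L s"
  shows "act X x \<in> L (Suc s)"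
  using assms(2) unfolding degree_filtration_def
proof (rule act_span[OF assms(1)])
  fix y assume "y \<in> {foldr act xs v |xs. length xs \<le> s \<and> set xs \<subseteq> \<gg>}"
  then obtain xs where "y = foldr act xs v" "length xs \<le> s" "set xs \<subseteq> \<gg>" by blast
  then have "act X y = foldr act (X # xs) v" "length (X # xs) \<le> Suc s" "set (X # xs) \<subseteq> \<gg>"
    using assms(1) by auto
  then show "act X y \<in> span {foldr act xs v |xs. length xs \<le> Suc s \<and> set xs \<subseteq> \<gg>}"
    by (intro span_base) blast
qed

lemma word_in_degree_filtration:
  assumes "set w \<subseteq> {..<N}"
  shows "foldr T w v \<in> L (length w)"
proof -
  have "foldr T w v = foldr act (map f w) v" by (simp add: foldr_map o_def)
  moreover have "set (map f w) \<subseteq> \<gg>" using assms basis by auto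
  ultimately show ?thesis
    unfolding degree_filtration_def by (intro span_base) (auto intro!: exI[of _ "map f w"])
qed

lemma subspace_degree_filtration: "subspace (L s)"
  by (simp add: degree_filtration_def)

text \<open>Each exchange of neighbours in a product costs a commutator, of smaller degree.\<close>

lemma insort_straighten:
  assumes "i < N" "set w \<subseteq> {..<N}"
  shows "T i (foldr T w v) - foldr T (insort i w) v \<in> L (length w)"
  using assms(2)
proof (induction w)
  case Nil
  then show ?case using subspace_0[OF subspace_degree_filtration] by simp
next
  case (Cons j w)
  let ?x = "foldr T w v"
  show ?case
  proof (cases "i \<le> j")
    case True
    then show ?thesis using subspace_0[OF subspace_degree_filtration] by simp
  next
    case False
    have ij: "f i \<in> \<gg>" "f j \<in> \<gg>" and w: "set w \<subseteq> {..<N}" using Cons.prems assms(1) basis by auto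
    obtain Z where Z: "Z \<in> \<gg>" "T i (T j ?x) - T j (T i ?x) = act Z ?x" using bracket[OF ij] by blast
    have "T i (T j ?x) - T j (foldr T (insort i w) v)
        = act Z ?x + T j (T i ?x - foldr T (insort i w) v)"
      by (simp add: act_diff[OF ij(2)] Z(2)[symmetric])
    moreover have "act Z ?x \<in> L (Suc (length w))"
      by (intro degree_filtration_act Z word_in_degree_filtration w)
    moreover have "T j (T i ?x - foldr T (insort i w) v) \<in> L (Suc (length w))"
      by (intro degree_filtration_act ij Cons.IH w)
    ultimately show ?thesis
      using False subspace_add[OF subspace_degree_filtration] by simp
  qed
qed

lemma sort_straighten:
  assumes "set w \<subseteq> {..<N}"
  shows "foldr T w v - foldr T (sort w) v \<in> L (length w - 1)"
  using assms
proof (induction w)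
  case Nil
  then show ?case using subspace_0[OF subspace_degree_filtration] by simp
next
  case (Cons i w)
  have i: "i < N" "f i \<in> \<gg>" and w: "set w \<subseteq> {..<N}" using Cons.prems basis by auto
  have "T i (foldr T w v - foldr T (sort w) v) \<in> L (length w)"
  proof (cases w)
    case Nil
    interpret act: Vector_Spaces.linear scl scl "T i" using i(2) by (rule act_linear)
    show ?thesis using Nil subspace_0[OF subspace_degree_filtration] by (simp add: act.zero)
  next
    case (Cons j w')
    then show ?thesis using degree_filtration_act[OF i(2) Cons.IH[OF w]] by simp
  qed
  moreover have "T i (foldr T (sort w) v) - foldr T (insort i (sort w)) v \<in> L (length w)"
    using insort_straighten[OF i(1), of "sort w"] w by simp
  ultimately have "T i (foldr T w v - foldr T (sort w) v)
      + (T i (foldr T (sort w) v) - foldr T (insort i (sort w)) v) \<in> L (length w)"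
    by (rule subspace_add[OF subspace_degree_filtration])
  then show ?case by (simp add: act_diff[OF i(2)])
qed

lemma product_in_span_words:
  "set xs \<subseteq> \<gg> \<Longrightarrow> foldr act xs v \<in> span {foldr T w v |w. length w = length xs \<and> set w \<subseteq> {..<N}}"
proof (induction xs)
  case Nil
  then show ?case by (intro span_base) auto
next
  case (Cons X xs)
  let ?W = "\<lambda>k. {foldr T w v |w. length w = k \<and> set w \<subseteq> {..<N}}"
  obtain c where c: "\<And>x. act X x = (\<Sum>k<N. scl (c k) (T k x))" using expand[of X] Cons.prems by auto
  have "T k (foldr act xs v) \<in> span (?W (length (X # xs)))" if k: "k < N" for k
  proof (rule act_span[OF basis[OF k]])
    show "foldr act xs v \<in> span (?W (length xs))" using Cons by simp
    fix y assume "y \<in> ?W (length xs)"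
    then obtain w where "y = foldr T w v" "length w = length xs" "set w \<subseteq> {..<N}" by blast
    then have "T k y = foldr T (k # w) v" "length (k # w) = length (X # xs)" "set (k # w) \<subseteq> {..<N}"
      using k by auto
    then show "T k y \<in> span (?W (length (X # xs)))" by (intro span_base) blast
  qed
  then show ?case by (auto simp: c intro!: span_sum span_scale)
qed

lemma monomial_in_degree_filtration:
  "q \<in> exponents N \<Longrightarrow> total_degree q \<le> s \<Longrightarrow> monomial N T q v \<in> L s"
  using word_in_degree_filtration[OF set_sorted_word, of q] degree_filtration_mono[of "total_degree q" s]
  by (auto simp: monomial_eq_word length_sorted_word)

text \<open>A word is its sorted rearrangement, which is a monomial, up to words of smaller degree; the
  latter are dealt with by induction.\<close>

lemma degree_filtration_eq_span_monomials:
  "L s = span ((\<lambda>q. monomial N T q v) ` {q \<in> exponents N. total_degree q \<le> s})" (is "_ = ?M s")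
proof
  show "?M s \<subseteq> L s"
    by (rule span_minimal[OF _ subspace_degree_filtration]) (auto intro: monomial_in_degree_filtration)
  have mono: "?M s \<subseteq> ?M t" if "s \<le> t" for s t using that by (intro span_mono) auto
  show "L s \<subseteq> ?M s"
  proof (induction s rule: less_induct)
    case (less s)
    have word: "foldr T w v \<in> ?M s" if w: "set w \<subseteq> {..<N}" "length w \<le> s" for w
    proof -
      have "foldr T (sort w) v \<in> ?M s"
        using w by (intro span_base image_eqI[of _ _ "content (sort w)"])
          (auto simp: monomial_content content_in_exponents total_degree_content[of _ N])
      moreover have "foldr T w v - foldr T (sort w) v \<in> ?M s"
      proof (cases w)
        case (Cons i w')
        then have "length w - 1 < s" using w(2) by auto
        then have "L (length w - 1) \<subseteq> ?M s"
          using less.IH[of "length w - 1"] mono[of "length w - 1" s] by simp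
        then show ?thesis using sort_straighten[OF w(1)] by blast
      qed (simp add: span_zero)
      ultimately have "foldr T (sort w) v + (foldr T w v - foldr T (sort w) v) \<in> ?M s"
        by (rule span_add)
      then show ?thesis by simp
    qed
    show ?case
      unfolding degree_filtration_def
    proof (rule span_minimal, clarify)
      fix xs assume xs: "length xs \<le> s" "set xs \<subseteq> \<gg>"
      have "span {foldr T w v |w. length w = length xs \<and> set w \<subseteq> {..<N}} \<subseteq> ?M s"
        using word xs(1) by (intro span_minimal) auto
      then show "foldr act xs v \<in> ?M s" using product_in_span_words[OF xs(2)] by blast
    qed simp
  qed
qed

lemma cyclic_module_eq_span_monomials:
  "cyclic_module scl \<gg> act v = span ((\<lambda>q. monomial N T q v) ` exponents N)"
proof
  show "cyclic_module scl \<gg> act v \<subseteq> span ((\<lambda>q. monomial N T q v) ` exponents N)"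
    unfolding cyclic_module_def
  proof (rule span_minimal, clarify)
    fix xs assume "set xs \<subseteq> \<gg>"
    then have "foldr act xs v \<in> L (length xs)"
      unfolding degree_filtration_def by (intro span_base) auto
    also have "\<dots> \<subseteq> span ((\<lambda>q. monomial N T q v) ` exponents N)"
      unfolding degree_filtration_eq_span_monomials by (intro span_mono) auto
    finally show "foldr act xs v \<in> span ((\<lambda>q. monomial N T q v) ` exponents N)" .
  qed simp
  have "L s \<subseteq> cyclic_module scl \<gg> act v" for s
    unfolding degree_filtration_def cyclic_module_def by (intro span_mono) auto
  then show "span ((\<lambda>q. monomial N T q v) ` exponents N) \<subseteq> cyclic_module scl \<gg> act v"
    using monomial_in_degree_filtration by (intro span_minimal) (auto simp: cyclic_module_def)
qed

end

section \<open>Bases of graded spaces\<close>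

context complex_vector_space
begin

lemma coset_eq_iff:
  assumes "subspace G"
  shows "u +o G = w +o G \<longleftrightarrow> u - w \<in> G"
proof
  assume "u +o G = w +o G"
  moreover have "u \<in> u +o G" using subspace_0[OF assms] by (auto simp: elt_set_plus_def)
  ultimately show "u - w \<in> G" by (auto simp: elt_set_plus_def)
next
  assume uw: "u - w \<in> G"
  have "u +o G = w +o ((u - w) +o G)" by (simp add: set_plus_rearrange2)
  also have "(u - w) +o G = G"
  proof
    show "(u - w) +o G \<subseteq> G" using subspace_add[OF assms uw] by (auto simp: elt_set_plus_def)
    show "G \<subseteq> (u - w) +o G"
    proof
      fix x assume "x \<in> G"
      then have "x - (u - w) \<in> G" using uw by (rule subspace_diff[OF assms])
      then show "x \<in> (u - w) +o G" by (auto simp: elt_set_plus_def intro!: bexI[of _ "x - (u - w)"])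
    qed
  qed
  finally show "u +o G = w +o G" .
qed

lemma subspace_plus_self: "subspace G \<Longrightarrow> G + G = G"
  using subspace_0 subspace_add by (auto simp: set_plus_def) (metis add.right_neutral)

lemma coset_add: "subspace G \<Longrightarrow> (u +o G) + (w +o G) = (u + w) +o G"
  by (simp add: set_plus_rearrange subspace_plus_self)

text \<open>Both the scalar multiplication of a graded space and the action on it are given by the pattern
  on the left-hand side, with \<open>A = G\<close> in the first case and \<open>A\<close>, \<open>G\<close> consecutive in the second.\<close>

lemma coset_image:
  fixes g :: "'v \<Rightarrow> 'v"
  assumes G: "subspace G" and g: "\<And>x y. g (x + y) = g x + g y"
    and A: "0 \<in> A" "g ` A \<subseteq> G"
  shows "g ` (u +o A) + G = g u +o G"
proof
  show "g ` (u +o A) + G \<subseteq> g u +o G"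
  proof
    fix x assume "x \<in> g ` (u +o A) + G"
    then obtain a y where "a \<in> A" "y \<in> G" "x = g (u + a) + y"
      by (auto simp: elt_set_plus_def set_plus_def)
    moreover have "g a + y \<in> G" using A(2) \<open>a \<in> A\<close> \<open>y \<in> G\<close> subspace_add[OF G] by blast
    ultimately show "x \<in> g u +o G" by (auto simp: elt_set_plus_def g add.assoc)
  qed
  show "g u +o G \<subseteq> g ` (u +o A) + G"
  proof
    fix x assume "x \<in> g u +o G"
    then obtain y where y: "y \<in> G" "x = g u + y" by (auto simp: elt_set_plus_def)
    have "u \<in> u +o A"
      unfolding elt_set_plus_def using A(1) by (intro CollectI bexI[of _ 0]) simp_all
    then show "x \<in> g ` (u +o A) + G" using y by (blast intro: set_plus_intro)
  qed
qed

text \<open>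
  Here \<open>d\<close> is the degree of a basis vector, and \<open>A i\<close> indexes the basis vectors that span \<open>G i\<close>.  As
  the basis is adapted to all steps of the filtration at once, the quotient \<open>F i / G i\<close> has the classes
  of the vectors of degree \<open>i\<close> as a basis.
\<close>

lemma graded_space_basis:
  fixes b :: "'j \<Rightarrow> 'v" and d :: "'j \<Rightarrow> 'i" and A :: "'i \<Rightarrow> 'j set" and I :: "'i set"
  assumes J: "finite J" and ind: "independent_family b J"
    and d: "\<And>j. j \<in> J \<Longrightarrow> d j \<in> I"
    and A: "\<And>i. i \<in> I \<Longrightarrow> A i \<subseteq> J" "\<And>j. j \<in> J \<Longrightarrow> j \<notin> A (d j)"
    and F: "\<And>i. i \<in> I \<Longrightarrow> F i = span (b ` (A i \<union> {j \<in> J. d j = i}))"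
    and G: "\<And>i. i \<in> I \<Longrightarrow> G i = span (b ` A i)"
  defines "h \<equiv> (\<lambda>j. homogeneous_element I G (d j) (b j))"
  shows "inj_on h J \<and> module_basis (graded_space scl I F G) (h ` J)"
proof
  let ?V = "graded_space scl I F G"
  define D where "D i = {j \<in> J. d j = i}" for i
  define cls where "cls u = (\<lambda>i\<in>I. u i +o G i)" for u
  have finA: "finite (A i)" if "i \<in> I" for i using A(1)[OF that] J by (rule finite_subset)
  have finD: "finite (D i)" for i using J by (simp add: D_def)
  have subG: "subspace (G i)" if "i \<in> I" for i using G[OF that] by simp
  have modV: "Module.module complex_field ?V"
    by (rule module_graded_space[OF vector_space_axioms]) (use F G in simp_all)
  interpret V: Module.module complex_field ?V by (rule modV)
  have cls_eq: "cls u = cls w \<longleftrightarrow> (\<forall>i\<in>I. u i - w i \<in> G i)" for u w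
    by (auto simp: cls_def fun_eq_iff restrict_def subG coset_eq_iff)
  have add: "cls u \<oplus>\<^bsub>?V\<^esub> cls w = cls (\<lambda>i. u i + w i)" for u w
    by (auto simp: graded_space_def cls_def fun_eq_iff subG coset_add)
  have zero: "\<zero>\<^bsub>?V\<^esub> = cls (\<lambda>i. 0)"
    by (auto simp: graded_space_def cls_def fun_eq_iff)
  have smult: "c \<odot>\<^bsub>?V\<^esub> cls u = cls (\<lambda>i. scl c (u i))" for c u
  proof -
    have "scl c ` (u i +o G i) + G i = scl c (u i) +o G i" if "i \<in> I" for i
      by (rule coset_image) (use subG[OF that] subspace_0 subspace_scale in \<open>auto simp: scale_right_distrib\<close>)
    then show ?thesis by (auto simp: graded_space_def cls_def fun_eq_iff)
  qed
  have h: "h j = cls (\<lambda>i. if i = d j then b j else 0)" for j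
    by (auto simp: h_def homogeneous_element_def cls_def fun_eq_iff)
  \<comment> \<open>A relation modulo \<open>G i\<close> among vectors of degree \<open>i\<close> is a relation among basis vectors with
    indices in the disjoint union of \<open>D i\<close> and \<open>A i\<close>.\<close>
  have indG: "c j = 0" if i: "i \<in> I" and c: "(\<Sum>j\<in>D i. scl (c j) (b j)) \<in> G i" and j: "j \<in> D i" for i c j
  proof -
    obtain c' where c': "(\<Sum>j\<in>D i. scl (c j) (b j)) = (\<Sum>j\<in>A i. scl (c' j) (b j))"
      using c G[OF i] span_image_finite[OF finA[OF i], of b] by auto
    have disj: "D i \<inter> A i = {}" using A(2) by (auto simp: D_def)
    let ?e = "\<lambda>j. if j \<in> D i then c j else - c' j"
    have "(\<Sum>j\<in>D i \<union> A i. scl (?e j) (b j))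
        = (\<Sum>j\<in>D i. scl (?e j) (b j)) + (\<Sum>j\<in>A i. scl (?e j) (b j))"
      using finD finA[OF i] disj by (rule sum.union_disjoint)
    also have "(\<Sum>j\<in>D i. scl (?e j) (b j)) = (\<Sum>j\<in>D i. scl (c j) (b j))"
      by (rule sum.cong) auto
    also have "(\<Sum>j\<in>A i. scl (?e j) (b j)) = - (\<Sum>j\<in>A i. scl (c' j) (b j))"
      unfolding sum_negf[symmetric] using disj by (intro sum.cong) auto
    finally have "(\<Sum>j\<in>D i \<union> A i. scl (?e j) (b j)) = 0" by (simp add: c')
    moreover have "D i \<union> A i \<subseteq> J" using A(1)[OF i] by (auto simp: D_def)
    ultimately have "?e j = 0"
      using independent_familyD[OF ind, of "D i \<union> A i" ?e j] finD finA[OF i] j by blast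
    then show "c j = 0" using j by simp
  qed
  have h_carrier: "h j \<in> carrier ?V" if "j \<in> J" for j
  proof -
    have "b j \<in> F (d j)" using F[OF d[OF that]] that by (auto intro: span_base)
    moreover have "0 \<in> F i" if "i \<in> I" for i using F[OF that] span_zero by simp
    moreover have "finite {i \<in> I. h j i \<noteq> G i}"
      by (rule finite_subset[of _ "{d j}"]) (auto simp: h cls_def)
    ultimately show ?thesis
      by (auto simp: graded_space_def h cls_def intro: exI[of _ "b j"] exI[of _ 0])
  qed
  show inj: "inj_on h J"
  proof (rule inj_onI, rule ccontr)
    fix j k assume jk: "j \<in> J" "k \<in> J" "h j = h k" "j \<noteq> k"
    let ?c = "\<lambda>l. if l = j then 1 else if l = k then -1 else 0"
    have "(\<Sum>l\<in>D (d j). scl (?c l) (b l)) = b j - (if d k = d j then b k else 0)"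
    proof -
      have "(\<Sum>l\<in>D (d j). scl (?c l) (b l))
          = (\<Sum>l\<in>D (d j). (if l = j then b l else 0) + (if l = k then - b l else 0))"
        using jk(4) by (intro sum.cong) auto
      also have "\<dots> = b j + (if d k = d j then - b k else 0)"
        using finD jk by (simp add: sum.distrib D_def)
      finally show ?thesis by simp
    qed
    also have "\<dots> \<in> G (d j)"
      using jk(3) d[OF jk(1)] by (auto simp: h cls_eq split: if_splits dest!: bspec[of _ _ "d j"])
    finally show False
      using indG[OF d[OF jk(1)], of ?c j] jk(1) by (simp add: D_def)
  qed
  have finsum: "finsum ?V (\<lambda>x. a x \<odot>\<^bsub>?V\<^esub> x) (h ` K) = cls (\<lambda>i. \<Sum>j\<in>{j \<in> K. d j = i}. scl (a (h j)) (b j))"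
    if "finite K" "K \<subseteq> J" for K and a :: "('i \<Rightarrow> 'v set) \<Rightarrow> complex"
    using that
  proof (induction K)
    case (insert k K)
    have "h k \<notin> h ` K" using inj insert by (auto dest: inj_onD)
    moreover have "(\<lambda>x. a x \<odot>\<^bsub>?V\<^esub> x) \<in> h ` K \<rightarrow> carrier ?V" "a (h k) \<odot>\<^bsub>?V\<^esub> h k \<in> carrier ?V"
      using insert.prems h_carrier by (auto intro!: V.smult_closed simp: complex_field_def)
    ultimately have "finsum ?V (\<lambda>x. a x \<odot>\<^bsub>?V\<^esub> x) (h ` insert k K)
        = a (h k) \<odot>\<^bsub>?V\<^esub> h k \<oplus>\<^bsub>?V\<^esub> cls (\<lambda>i. \<Sum>j\<in>{j \<in> K. d j = i}. scl (a (h j)) (b j))"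
      using insert by simp
    also have "a (h k) \<odot>\<^bsub>?V\<^esub> h k = cls (\<lambda>i. scl (a (h k)) (if i = d k then b k else 0))"
      by (simp only: h[of k] smult)
    also have "\<dots> \<oplus>\<^bsub>?V\<^esub> cls (\<lambda>i. \<Sum>j\<in>{j \<in> K. d j = i}. scl (a (h j)) (b j))
        = cls (\<lambda>i. scl (a (h k)) (if i = d k then b k else 0) + (\<Sum>j\<in>{j \<in> K. d j = i}. scl (a (h j)) (b j)))"
      by (rule add)
    also have "\<dots> = cls (\<lambda>i. \<Sum>j\<in>{j \<in> insert k K. d j = i}. scl (a (h j)) (b j))"
    proof (rule arg_cong[of _ _ cls], rule ext)
      fix i
      have "{j \<in> insert k K. d j = i} = (if i = d k then insert k {j \<in> K. d j = i} else {j \<in> K. d j = i})"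
        by auto
      then show "scl (a (h k)) (if i = d k then b k else 0) + (\<Sum>j\<in>{j \<in> K. d j = i}. scl (a (h j)) (b j))
          = (\<Sum>j\<in>{j \<in> insert k K. d j = i}. scl (a (h j)) (b j))"
        using insert.hyps by simp
    qed
    finally show ?case .
  qed (simp add: zero)
  \<comment> \<open>Vectors with coefficient 0 may be kept in the sum over the support.\<close>
  have finsum_support: "finsum ?V (\<lambda>x. a x \<odot>\<^bsub>?V\<^esub> x) {x \<in> h ` J. a x \<noteq> 0}
      = cls (\<lambda>i. \<Sum>j\<in>D i. scl (a (h j)) (b j))" for a :: "('i \<Rightarrow> 'v set) \<Rightarrow> complex"
  proof -
    have "{x \<in> h ` J. a x \<noteq> 0} = h ` {j \<in> J. a (h j) \<noteq> 0}" by auto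
    moreover have "(\<Sum>j\<in>{j \<in> {j \<in> J. a (h j) \<noteq> 0}. d j = i}. scl (a (h j)) (b j))
        = (\<Sum>j\<in>D i. scl (a (h j)) (b j))" for i
      using J by (intro sum.mono_neutral_left) (auto simp: D_def)
    ultimately show ?thesis using finsum[of "{j \<in> J. a (h j) \<noteq> 0}" a] J by simp
  qed
  show "module_basis ?V (h ` J)"
    unfolding module_basis_def
  proof (intro conjI ballI ex_ex1I)
    show "h ` J \<subseteq> carrier ?V" using h_carrier by blast
  next
    fix x assume x: "x \<in> carrier ?V"
    then have "\<forall>i\<in>I. \<exists>u\<in>F i. x i = u +o G i" and ext: "x \<in> extensional I"
      by (auto simp: graded_space_def PiE_def Pi_iff)
    then obtain u where u: "\<And>i. i \<in> I \<Longrightarrow> u i \<in> F i" "\<And>i. i \<in> I \<Longrightarrow> x i = u i +o G i" by metis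
    have "\<exists>c. u i - (\<Sum>j\<in>D i. scl (c j) (b j)) \<in> G i" if i: "i \<in> I" for i
    proof -
      have "finite (A i \<union> D i)" using finA[OF i] finD by blast
      then obtain c where "u i = (\<Sum>j\<in>A i \<union> D i. scl (c j) (b j))"
        using u(1)[OF i] F[OF i] span_image_finite[of "A i \<union> D i" b] unfolding D_def by auto
      also have "\<dots> = (\<Sum>j\<in>A i. scl (c j) (b j)) + (\<Sum>j\<in>D i. scl (c j) (b j))"
        using finA[OF i] finD A(2) by (intro sum.union_disjoint) (auto simp: D_def)
      finally have "u i - (\<Sum>j\<in>D i. scl (c j) (b j)) = (\<Sum>j\<in>A i. scl (c j) (b j))" by simp
      also have "\<dots> \<in> G i" unfolding G[OF i] by (intro span_sum span_scale span_base imageI)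
      finally show ?thesis by blast
    qed
    then obtain c where c: "\<And>i. i \<in> I \<Longrightarrow> u i - (\<Sum>j\<in>D i. scl (c i j) (b j)) \<in> G i" by metis
    define a where "a = (\<lambda>y\<in>h ` J. let j = the_inv_into J h y in c (d j) j)"
    have a: "a (h j) = c (d j) j" if "j \<in> J" for j
      using that by (simp add: a_def the_inv_into_f_f[OF inj])
    have "x = cls u" using u(2) ext by (auto simp: cls_def fun_eq_iff extensional_def)
    also have "\<dots> = cls (\<lambda>i. \<Sum>j\<in>D i. scl (a (h j)) (b j))"
    proof -
      have "(\<Sum>j\<in>D i. scl (a (h j)) (b j)) = (\<Sum>j\<in>D i. scl (c i j) (b j))" for i
        by (rule sum.cong) (auto simp: D_def a)
      then show ?thesis using c by (simp add: cls_eq)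
    qed
    finally have "x = finsum ?V (\<lambda>y. a y \<odot>\<^bsub>?V\<^esub> y) {y \<in> h ` J. a y \<noteq> 0}" by (simp only: finsum_support)
    moreover have "a \<in> extensional (h ` J)" by (simp add: a_def)
    ultimately show "\<exists>a. a \<in> extensional (h ` J) \<and> finite {y \<in> h ` J. a y \<noteq> 0} \<and>
        x = finsum ?V (\<lambda>y. a y \<odot>\<^bsub>?V\<^esub> y) {y \<in> h ` J. a y \<noteq> 0}"
      using J by (intro exI[of _ a]) simp
  next
    fix x a a'
    assume "a \<in> extensional (h ` J) \<and> finite {y \<in> h ` J. a y \<noteq> 0} \<and>
        x = finsum ?V (\<lambda>y. a y \<odot>\<^bsub>?V\<^esub> y) {y \<in> h ` J. a y \<noteq> 0}"
      "a' \<in> extensional (h ` J) \<and> finite {y \<in> h ` J. a' y \<noteq> 0} \<and>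
        x = finsum ?V (\<lambda>y. a' y \<odot>\<^bsub>?V\<^esub> y) {y \<in> h ` J. a' y \<noteq> 0}"
    then have ext: "a \<in> extensional (h ` J)" "a' \<in> extensional (h ` J)"
      and eq: "cls (\<lambda>i. \<Sum>j\<in>D i. scl (a (h j)) (b j)) = cls (\<lambda>i. \<Sum>j\<in>D i. scl (a' (h j)) (b j))"
      by (simp_all add: finsum_support)
    show "a = a'"
    proof (rule extensionalityI[OF ext])
      fix y assume "y \<in> h ` J"
      then obtain j where j: "j \<in> J" "y = h j" by blast
      have "(\<Sum>j\<in>D (d j). scl (a (h j)) (b j)) - (\<Sum>j\<in>D (d j). scl (a' (h j)) (b j)) \<in> G (d j)"
        using eq d[OF j(1)] unfolding cls_eq by blast
      then have "(\<Sum>j\<in>D (d j). scl (a (h j) - a' (h j)) (b j)) \<in> G (d j)"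
        by (simp add: scale_left_diff_distrib sum_subtractf)
      then have "a (h j) - a' (h j) = 0"
        using indG[OF d[OF j(1)], of "\<lambda>j. a (h j) - a' (h j)" j] j(1) by (simp add: D_def)
      then show "a y = a' y" using j(2) by simp
    qed
  qed
qed

end



section \<open>The two graded versions of a cyclic module\<close>

lemma foldr_homogeneous_element:
  fixes x :: 'v
  assumes "set w \<subseteq> {..<N}"
    and "\<And>i u. i < N \<Longrightarrow> set u \<subseteq> {..<N} \<Longrightarrow>
      S i (H (d u) (foldr T u x)) = H (d (i # u)) (T i (foldr T u x))"
  shows "foldr S w (H (d []) x) = H (d w) (foldr T w x)"
  using assms(1) by (induction w) (auto simp: assms(2))

locale ordered_lie_module = lie_module scl \<gg> act f N v + monomial_order N lt
  for scl :: "complex \<Rightarrow> 'v::ab_group_add \<Rightarrow> 'v" and \<gg> :: "'g set" and act f N v lt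
begin

sublocale ordered_monomials scl N lt "\<lambda>i. act (f i)" v
  by unfold_locales

abbreviation "L' s \<equiv> degree_filtration_less scl \<gg> act v s"
abbreviation "Fl p \<equiv> filtration_less scl N lt (\<lambda>i. act (f i)) v p"

lemma degree_filtration_eq_span_essential: "L s = span (b ` {q \<in> es. total_degree q \<le> s})"
proof -
  have "span (b ` {q \<in> exponents N. total_degree q \<le> s})
      = span (b ` ({q \<in> exponents N. total_degree q \<le> s} \<inter> es))"
    using lt_degree_le by (intro span_essential) (auto intro: le_trans)
  also have "{q \<in> exponents N. total_degree q \<le> s} \<inter> es = {q \<in> es. total_degree q \<le> s}"
    using es_subset by auto
  finally show ?thesis by (simp add: degree_filtration_eq_span_monomials)
qed

lemma degree_filtration_less_eq_span_essential: "L' s = span (b ` {q \<in> es. total_degree q < s})"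
  by (cases s) (simp_all add: degree_filtration_less_def degree_filtration_eq_span_essential less_Suc_eq_le)

lemma subspace_degree_filtration_less: "subspace (L' s)"
  by (simp add: degree_filtration_less_eq_span_essential)

lemma subspace_filtration_less: "subspace (Fl p)"
  by (simp add: filtration_less_def)

lemma act_add: "X \<in> \<gg> \<Longrightarrow> act X (x + y) = act X x + act X y"
  using act_linear by (auto simp: Vector_Spaces.linear_def intro: module_hom.add)

lemma act_0: "X \<in> \<gg> \<Longrightarrow> act X 0 = 0"
  using act_linear by (auto simp: Vector_Spaces.linear_def intro: module_hom.zero)

lemma degree_filtration_less_act: "X \<in> \<gg> \<Longrightarrow> act X ` L' s \<subseteq> L s"
  using degree_filtration_act[of X _ "s - 1"] subspace_0[OF subspace_degree_filtration]
  by (cases s) (auto simp: degree_filtration_less_def act_0)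

lemma gr_a_action_homogeneous:
  assumes X: "X \<in> \<gg>"
  shows "gr_a_action scl \<gg> act v X (homogeneous_element UNIV L' s u)
    = homogeneous_element UNIV L' (Suc s) (act X u)"
proof
  fix t
  show "gr_a_action scl \<gg> act v X (homogeneous_element UNIV L' s u) t
    = homogeneous_element UNIV L' (Suc s) (act X u) t"
  proof (cases t)
    case 0
    then show ?thesis by (simp add: gr_a_action_def homogeneous_element_def)
  next
    case (Suc r)
    have "L' (Suc r) = L r" by (simp add: degree_filtration_less_def)
    moreover have "act X ` (y +o L' r) + L r = act X y +o L r" for y
      using degree_filtration_less_act[OF X] subspace_0[OF subspace_degree_filtration_less] act_add[OF X]
      by (intro coset_image subspace_degree_filtration)
    moreover have "act X ` L' r + L r = L r" using calculation(2)[of 0] by (simp add: act_0[OF X])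
    ultimately show ?thesis
      using Suc by (auto simp: gr_a_action_def homogeneous_element_def)
  qed
qed

lemma gr_a_monomial:
  assumes p: "p \<in> exponents N"
  shows "monomial N (\<lambda>i. gr_a_action scl \<gg> act v (f i)) p (gr_a_generator scl \<gg> act v)
    = homogeneous_element UNIV L' (total_degree p) (b p)"
proof -
  have "foldr (\<lambda>i. gr_a_action scl \<gg> act v (f i)) w (homogeneous_element UNIV L' (length ([] :: nat list)) v)
      = homogeneous_element UNIV L' (length w) (foldr T w v)" if "set w \<subseteq> {..<N}" for w
    using that by (rule foldr_homogeneous_element) (simp add: gr_a_action_homogeneous basis)
  from this[OF set_sorted_word[of N p]] show ?thesis
    by (simp add: monomial_eq_word gr_a_generator_def length_sorted_word p)
qed

text \<open>
  Left multiplication by \<open>f i\<close> produces the monomial of exponent \<open>q + e\<^sub>i\<close> up to terms of degree at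
  most \<open>|q|\<close>, which are smaller because the order is homogeneous.
\<close>

lemma filtration_less_act:
  assumes i: "i < N" and p: "p \<in> exponents N"
  shows "T i ` Fl p \<subseteq> Fl (p + Poly_Mapping.single i 1)"
proof clarify
  fix x assume "x \<in> Fl p"
  let ?p = "p + Poly_Mapping.single i 1"
  have ei: "Poly_Mapping.single i 1 \<in> exponents N" by (rule single_in_exponents[OF i])
  then have p': "?p \<in> exponents N" using p by (rule exponents_add[rotated])
  have deg: "total_degree ?p = Suc (total_degree p)"
    using total_degree_add[OF p ei] by (simp add: total_degree_def)
  show "T i x \<in> Fl ?p"
    using \<open>x \<in> Fl p\<close> unfolding filtration_less_eq_span
  proof (rule act_span[OF basis[OF i]])
    fix y assume "y \<in> b ` {q \<in> exponents N. lt q p}"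
    then obtain q where q: "q \<in> exponents N" "lt q p" "y = b q" by blast
    let ?w = "insort i (sorted_word N q)"
    have w: "sorted ?w" "set ?w \<subseteq> {..<N}"
      using i set_sorted_word[of N q] sorted_sorted_word by (auto simp: sorted_insort set_insort_key)
    have content: "content ?w = q + Poly_Mapping.single i 1"
      using content_cong[of ?w "i # sorted_word N q"] by (simp add: content_sorted_word q(1) add.commute)
    have "foldr T ?w v = b (q + Poly_Mapping.single i 1)"
      using monomial_content[OF w, of T v] content by simp
    moreover have "q + Poly_Mapping.single i 1 \<in> exponents N" "lt (q + Poly_Mapping.single i 1) ?p"
      using lt_add[OF q(1) p ei q(2)] exponents_add[OF q(1) ei] by auto
    ultimately have lead: "foldr T ?w v \<in> span (b ` {q \<in> exponents N. lt q ?p})"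
      by (auto intro: span_base)
    have "T i (b q) - foldr T ?w v \<in> L (total_degree q)"
      using insort_straighten[OF i set_sorted_word, of q] by (simp add: monomial_eq_word length_sorted_word q(1))
    moreover have "L (total_degree q) \<subseteq> span (b ` {q \<in> exponents N. lt q ?p})"
      unfolding degree_filtration_eq_span_monomials
    proof (intro span_mono image_mono subsetI)
      fix r assume r: "r \<in> {r \<in> exponents N. total_degree r \<le> total_degree q}"
      then have "total_degree r < total_degree ?p"
        using lt_degree_le[OF q(1) p q(2)] deg by simp
      then show "r \<in> {q \<in> exponents N. lt q ?p}" using r p' lt_degree by blast
    qed
    ultimately have "foldr T ?w v + (T i (b q) - foldr T ?w v) \<in> span (b ` {q \<in> exponents N. lt q ?p})"
      using lead by (intro span_add) auto
    then show "T i y \<in> span (b ` {q \<in> exponents N. lt q ?p})" by (simp add: q(3))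
  qed
qed

lemma gr_t_action_homogeneous:
  assumes i: "i < N" and p: "p \<in> exponents N"
  shows "gr_t_action scl N lt T v i (homogeneous_element (exponents N) Fl p u)
    = homogeneous_element (exponents N) Fl (p + Poly_Mapping.single i 1) (T i u)"
proof
  fix q
  let ?e = "Poly_Mapping.single i 1 :: exponent"
  show "gr_t_action scl N lt T v i (homogeneous_element (exponents N) Fl p u) q
    = homogeneous_element (exponents N) Fl (p + ?e) (T i u) q"
  proof (cases "q \<in> exponents N")
    case q: True
    show ?thesis
    proof (cases "Poly_Mapping.lookup q i = 0")
      case True
      then have "q \<noteq> p + ?e" by (auto simp: lookup_add)
      then show ?thesis using q True by (simp add: gr_t_action_def homogeneous_element_def)
    next
      case False
      define r where "r = q - ?e"
      have qr: "q = r + ?e"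
        using False by (intro poly_mapping_eqI) (auto simp: r_def lookup_add lookup_minus lookup_single when_def)
      have r: "r \<in> exponents N"
        using q by (auto simp: qr exponents_def in_keys_iff lookup_add subset_iff)
      have "T i ` (y +o Fl r) + Fl q = T i y +o Fl q" for y
        using filtration_less_act[OF i r] act_add[OF basis[OF i]]
          subspace_0[OF subspace_filtration_less] subspace_filtration_less
        by (intro coset_image) (auto simp: qr)
      from this[of u] this[of 0] show ?thesis
        using q False r
        by (simp add: gr_t_action_def homogeneous_element_def act_0[OF basis[OF i]] r_def[symmetric] p)
          (auto simp: qr p)
    qed
  qed (simp add: gr_t_action_def homogeneous_element_def)
qed

lemma gr_t_monomial:
  assumes p: "p \<in> exponents N"
  shows "monomial N (gr_t_action scl N lt T v) p (gr_t_generator scl N lt T v)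
    = homogeneous_element (exponents N) Fl p (b p)"
proof -
  have "foldr (gr_t_action scl N lt T v) w (homogeneous_element (exponents N) Fl (content []) v)
      = homogeneous_element (exponents N) Fl (content w) (foldr T w v)" if "set w \<subseteq> {..<N}" for w
    using that
    by (rule foldr_homogeneous_element) (simp add: gr_t_action_homogeneous content_in_exponents add.commute)
  from this[OF set_sorted_word[of N p]] show ?thesis
    by (simp add: monomial_eq_word gr_t_generator_def content_sorted_word p)
qed

lemma gr_a_basis:
  assumes "finite es"
  defines "h \<equiv> (\<lambda>p. monomial N (\<lambda>i. gr_a_action scl \<gg> act v (f i)) p (gr_a_generator scl \<gg> act v))"
  shows "inj_on h es \<and> module_basis (gr_a scl \<gg> act v) (h ` es)"
proof -
  have h: "h p = homogeneous_element UNIV L' (total_degree p) (b p)" if "p \<in> es" for p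
    using that es_subset by (auto simp: h_def gr_a_monomial)
  have "{q \<in> es. total_degree q \<le> s} = {q \<in> es. total_degree q < s} \<union> {q \<in> es. total_degree q = s}" for s
    by auto
  then have "inj_on (\<lambda>p. homogeneous_element UNIV L' (total_degree p) (b p)) es \<and>
      module_basis (graded_space scl UNIV L L') ((\<lambda>p. homogeneous_element UNIV L' (total_degree p) (b p)) ` es)"
    by (intro graded_space_basis[where A = "\<lambda>s. {q \<in> es. total_degree q < s}"] assms essential_independent)
      (auto simp: degree_filtration_eq_span_essential degree_filtration_less_eq_span_essential)
  then show ?thesis
    using h by (simp add: gr_a_def inj_on_cong[of es h] image_cong[of es es h])
qed

lemma gr_t_basis:
  assumes "finite es"
  defines "h \<equiv> (\<lambda>p. monomial N (gr_t_action scl N lt T v) p (gr_t_generator scl N lt T v))"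
  shows "inj_on h es \<and> module_basis (gr_t scl N lt T v) (h ` es)"
proof -
  have h: "h p = homogeneous_element (exponents N) Fl p (b p)" if "p \<in> es" for p
    using that es_subset by (auto simp: h_def gr_t_monomial)
  have "{q \<in> es. lt q p \<or> q = p} = {q \<in> es. lt q p} \<union> {q \<in> es. q = p}" for p
    by auto
  then have "inj_on (\<lambda>p. homogeneous_element (exponents N) Fl p (b p)) es \<and>
      module_basis (graded_space scl (exponents N) (filtration_le scl N lt T v) Fl)
        ((\<lambda>p. homogeneous_element (exponents N) Fl p (b p)) ` es)"
    using es_subset lt_irrefl
    by (intro graded_space_basis[where A = "\<lambda>p. {q \<in> es. lt q p}" and d = "\<lambda>p. p"] assms essential_independent)
      (auto simp: filtration_le_eq_span_essential filtration_less_eq_span_essential)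
  then show ?thesis
    using h by (simp add: gr_t_def inj_on_cong[of es h] image_cong[of es es h])
qed

lemma essential_exponents_eq:
  assumes "K \<subseteq> es" "finite K" "K \<noteq> {}" "dim (cyclic_module scl \<gg> act v) = card K"
  shows "es = K" "inj_on b K" "independent (b ` K)" "span (b ` K) = cyclic_module scl \<gg> act v"
proof -
  have "b ` es \<subseteq> span (b ` exponents N)" using es_subset by (auto intro: span_base)
  from card_eq_dim_spans[OF essential_independent this assms(1-3)] assms(4)
  show "es = K" "span (b ` K) = cyclic_module scl \<gg> act v"
    by (simp_all add: cyclic_module_eq_span_monomials)
  then show "inj_on b K" "independent (b ` K)"
    using independent_family_inj[OF essential_independent]
      independent_family_independent[OF essential_independent] by auto
qed

end

section \<open>Cartan components of a favourable module\<close>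

lemma lattice_exponents_eq_essential:
  assumes "lattice_points N P = real_exponent ` E" "E \<subseteq> exponents N"
  shows "lattice_exponents N P = E"
proof
  have lookup: "Poly_Mapping.lookup (real_exponent p) i = real (Poly_Mapping.lookup p i)" for p i
    by (simp add: real_exponent_def Poly_Mapping.map.rep_eq when_def)
  then have inj: "real_exponent p = real_exponent q \<Longrightarrow> p = q" for p q
    by (metis of_nat_eq_iff poly_mapping_eqI)
  show "E \<subseteq> lattice_exponents N P"
    using assms by (auto simp: lattice_exponents_def lattice_points_def)
  show "lattice_exponents N P \<subseteq> E"
  proof
    fix p assume p: "p \<in> lattice_exponents N P"
    have "Poly_Mapping.keys (real_exponent p) = Poly_Mapping.keys p"
      by (auto simp: in_keys_iff lookup)
    then have "Poly_Mapping.keys (real_exponent p) \<subseteq> {..<N}"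
      using p by (simp add: lattice_exponents_def exponents_def)
    then have "real_exponent p \<in> lattice_points N P"
      using p by (auto simp: lattice_points_def lattice_exponents_def lookup)
    then show "p \<in> E" using assms(1) inj by auto
  qed
qed

lemma lie_algebra_expand:
  assumes f: "ordered_basis N f (lie_algebra U)" and \<rho>: "rational_representation U \<rho>"
    and X: "X \<in> lie_algebra U"
  shows "\<exists>c. \<forall>S. lie_tensor_action U \<rho> X S = (\<Sum>k<N. tensor_scale (c k) (lie_tensor_action U \<rho> (f k) S))"
proof -
  interpret complex_vector_space matrix_scale
    by (simp add: complex_vector_space_def vector_space_matrix_scale)
  have fU: "f k \<in> lie_algebra U" if "k < N" for k
    using f that by (auto simp: ordered_basis_def intro: span_base)
  have scl: "matrix_scale c Y \<in> lie_algebra U" if "Y \<in> lie_algebra U" for c Y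
    using that by (rule lie_algebra_scale)
  obtain c where c: "X = (\<Sum>k\<in>{..<N}. matrix_scale (c k) (f k))"
    using X f span_image_finite[of "{..<N}" f] by (auto simp: ordered_basis_def)
  have "(\<Sum>k\<in>K. matrix_scale (c k) (f k)) \<in> lie_algebra U \<and>
      tensor_action (differential U \<rho> (\<Sum>k\<in>K. matrix_scale (c k) (f k))) S
      = (\<Sum>k\<in>K. tensor_scale (c k) (tensor_action (differential U \<rho> (f k)) S))"
    if "finite K" "K \<subseteq> {..<N}" for K S
    using that
  proof (induction K)
    case empty
    have "0 = matrix_scale 0 X" by simp
    then have "0 \<in> lie_algebra U" "differential U \<rho> 0 = 0"
      using scl[OF X, of 0] differential_scale[OF \<rho> X, of 0] by simp_all
    then show ?case by (simp add: tensor_action_def fun_eq_iff)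
  next
    case (insert k K)
    have k: "matrix_scale (c k) (f k) \<in> lie_algebra U" "f k \<in> lie_algebra U"
      using insert.prems fU scl by auto
    then show ?case
      using insert
      by (simp add: lie_algebra_add differential_add[OF \<rho>] differential_scale[OF \<rho>]
          tensor_action_matrix_add tensor_action_matrix_scale del: plus_fun_apply)
  qed
  then show ?thesis unfolding lie_tensor_action_def c by blast
qed

lemma lie_module_tensor:
  assumes U: "unipotent_algebraic_group U" and \<rho>: "rational_representation U \<rho>"
    and f: "ordered_basis N f (lie_algebra U)"
  shows "lie_module tensor_scale (lie_algebra U) (lie_tensor_action U \<rho>) f N"
proof -
  interpret vector_space_pair tensor_scale tensor_scale
    by (simp add: vector_space_pair_def vector_space_tensor_scale)
  interpret matrix: vector_space matrix_scale by (rule vector_space_matrix_scale)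
  have mult: "g ** h \<in> U" if "g \<in> U" "h \<in> U" for g h
    using U that by (simp add: unipotent_algebraic_group_def)
  show ?thesis
  proof (rule lie_module.intro[OF complex_vector_space.intro[OF vector_space_tensor_scale] lie_module_axioms.intro])
    fix X assume X: "X \<in> lie_algebra U"
    show "Vector_Spaces.linear tensor_scale tensor_scale (lie_tensor_action U \<rho> X)"
      by unfold_locales (simp_all only: lie_tensor_action_def tensor_action_add tensor_action_scale)
    show "\<exists>c. \<forall>S. lie_tensor_action U \<rho> X S = (\<Sum>k<N. tensor_scale (c k) (lie_tensor_action U \<rho> (f k) S))"
      by (rule lie_algebra_expand[OF f \<rho> X])
  next
    fix X Y assume X: "X \<in> lie_algebra U" and Y: "Y \<in> lie_algebra U"
    show "\<exists>Z\<in>lie_algebra U. \<forall>S. lie_tensor_action U \<rho> X (lie_tensor_action U \<rho> Y S)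
        - lie_tensor_action U \<rho> Y (lie_tensor_action U \<rho> X S) = lie_tensor_action U \<rho> Z S"
      using lie_algebra_bracket[OF mult X Y] differential_bracket[OF mult \<rho> X Y]
      by (intro bexI[of _ "lie_bracket X Y"])
        (simp_all add: lie_tensor_action_def tensor_action_bracket del: minus_apply)
  next
    fix i assume "i < N"
    then show "f i \<in> lie_algebra U"
      using f by (auto simp: ordered_basis_def intro: matrix.span_base)
  qed
qed

lemma minkowski_multiple_finite: "finite S \<Longrightarrow> finite (minkowski_multiple n S)"
  by (induction n) (auto simp: minkowski_multiple_def finite_set_plus)

lemma zero_in_minkowski_multiple: "0 \<in> S \<Longrightarrow> 0 \<in> minkowski_multiple n S"
  by (induction n) (auto simp: minkowski_multiple_def set_plus_def intro!: bexI[of _ 0])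

lemma essential_exponents_favourable:
  fixes U :: "(complex^'m^'m) set" and \<rho> :: "complex^'m^'m \<Rightarrow> complex^'d^'d"
  assumes fav: "favourable_wrt U \<rho> v N f lt P" and "v \<noteq> 0"
  defines "E \<equiv> essential_exponents (*s) N lt (\<lambda>i. lie_action U \<rho> (f i)) v"
  shows "finite E" "0 \<in> E" "lattice_exponents N P = E"
proof -
  interpret monomial_order N lt
    using fav by unfold_locales (simp add: favourable_wrt_def)
  interpret ordered_monomials "(*s)" N lt "\<lambda>i. lie_action U \<rho> (f i)" v
    by unfold_locales
  have E: "E = es" by (simp add: E_def)
  show "lattice_exponents N P = E"
    using fav es_subset by (intro lattice_exponents_eq_essential) (simp_all add: favourable_wrt_def E)
  have "finite (b ` E)"
    unfolding E
    by (rule vec.finiteI_independent) (rule independent_family_independent[OF essential_independent])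
  then show "finite E" unfolding E by (rule finite_imageD) (rule independent_family_inj[OF essential_independent])
  have "filtration_less (*s) N lt (\<lambda>i. lie_action U \<rho> (f i)) v 0 = {0}"
    using not_lt_zero by (simp add: filtration_less_eq_span Collect_empty_eq[THEN iffD2])
  then show "0 \<in> E"
    using assms(2) zero_in_exponents by (simp add: E essential_exponents_def monomial_zero)
qed

theorem mainTheorem1:
  fixes U :: "(complex^'m^'m) set"
    and \<rho> :: "complex^'m^'m \<Rightarrow> complex^'d^'d"
    and v\<^sub>M :: "complex^'d"
    and N n :: nat
    and f :: "nat \<Rightarrow> complex^'m^'m"
    and lt :: "exponent \<Rightarrow> exponent \<Rightarrow> bool"
    and P :: "(nat \<Rightarrow>\<^sub>0 real) set"
  defines "\<NN> \<equiv> lie_algebra U"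
    and "act \<equiv> lie_tensor_action U \<rho>"
    and "T \<equiv> (\<lambda>i. lie_tensor_action U \<rho> (f i))"
    and "v\<^sub>n \<equiv> tensor_power_vector n v\<^sub>M"
    and "nS \<equiv> minkowski_multiple n (lattice_exponents N P)"
  defines "b \<equiv> (\<lambda>p. monomial N T p v\<^sub>n)"
    and "b_a \<equiv> (\<lambda>p. monomial N (\<lambda>i. gr_a_action tensor_scale \<NN> act v\<^sub>n (f i)) p
                  (gr_a_generator tensor_scale \<NN> act v\<^sub>n))"
    and "b_t \<equiv> (\<lambda>p. monomial N (gr_t_action tensor_scale N lt T v\<^sub>n) p
                  (gr_t_generator tensor_scale N lt T v\<^sub>n))"
  assumes "unipotent_algebraic_group U"
    and "rational_representation U \<rho>"
    and "v\<^sub>M \<noteq> 0"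
    and "cyclic_module (*s) \<NN> (lie_action U \<rho>) v\<^sub>M = UNIV"
    and "favourable_wrt U \<rho> v\<^sub>M N f lt P"
    and "n \<ge> 1"
  shows "(inj_on b nS \<and> \<not> Modules.module.dependent tensor_scale (b ` nS) \<and>
            Modules.module.span tensor_scale (b ` nS) = cartan_component U \<rho> v\<^sub>M n) \<and>
         (inj_on b_a nS \<and> module_basis (gr_a tensor_scale \<NN> act v\<^sub>n) (b_a ` nS)) \<and>
         (inj_on b_t nS \<and> module_basis (gr_t tensor_scale N lt T v\<^sub>n) (b_t ` nS))"
proof -
  let ?E = "essential_exponents (*s) N lt (\<lambda>i. lie_action U \<rho> (f i)) v\<^sub>M"
  have order: "homogeneous_monomial_order N lt" and f: "ordered_basis N f (lie_algebra U)"
    and dim: "vector_space.dim tensor_scale (cartan_component U \<rho> v\<^sub>M n) = card nS"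
    using assms by (simp_all add: favourable_wrt_def nS_def)
  interpret lie_module tensor_scale \<NN> act f N v\<^sub>n
    unfolding \<NN>_def act_def using lie_module_tensor assms f by blast
  interpret ordered_lie_module tensor_scale \<NN> act f N v\<^sub>n lt
    by unfold_locales (rule order)
  have cartan: "cartan_component U \<rho> v\<^sub>M n = cyclic_module tensor_scale \<NN> act v\<^sub>n"
    by (simp add: cartan_component_def \<NN>_def act_def v\<^sub>n_def)
  have T: "T = (\<lambda>i. act (f i))" by (simp add: T_def act_def)
  note E = essential_exponents_favourable[OF \<open>favourable_wrt U \<rho> v\<^sub>M N f lt P\<close> \<open>v\<^sub>M \<noteq> 0\<close>]
  have "nS \<subseteq> essential_exponents tensor_scale N lt T v\<^sub>n"
    using minkowski_multiple_essential[of n "\<lambda>i. differential U \<rho> (f i)" v\<^sub>M]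
    by (simp add: nS_def E(3) T_def v\<^sub>n_def lie_tensor_action_def lie_action_def[abs_def])
  moreover have "finite nS" "nS \<noteq> {}"
    using minkowski_multiple_finite[OF E(1), of n] zero_in_minkowski_multiple[OF E(2), of n]
    by (auto simp: nS_def E(3))
  ultimately have "essential_exponents tensor_scale N lt T v\<^sub>n = nS"
    and "inj_on b nS" "\<not> dependent (b ` nS)" "span (b ` nS) = cyclic_module tensor_scale \<NN> act v\<^sub>n"
    using essential_exponents_eq[of nS] dim by (simp_all add: T cartan b_def)
  moreover from this \<open>finite nS\<close> have "inj_on b_a nS \<and> module_basis (gr_a tensor_scale \<NN> act v\<^sub>n) (b_a ` nS)"
    "inj_on b_t nS \<and> module_basis (gr_t tensor_scale N lt T v\<^sub>n) (b_t ` nS)"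
    using gr_a_basis gr_t_basis by (simp_all add: T b_a_def b_t_def)
  ultimately show ?thesis by (simp add: cartan)
qed

end
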